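(* Let $\mathcal{A}$, $\mathcal{B}$ and $\mathcal{C}$ be pairwise disjoint subsets of $\mathcal{P}^{(1)}$. If $\mathcal{A}$ has a computable numbering, $\mathcal{B}$ and $\mathcal{C}$ have Friedberg numberings, and $\mathcal{B}$ is strongly dense in $\mathcal{A}\cup\mathcal{C}$, then there exists a uniformly c.e. independent sequence $\{\nu_i\}_{i\in\mathbb{N}}$ of Friedberg numberings of $\mathcal{A}\cup\mathcal{B}\cup\mathcal{C}$.
   Context: $\mathcal{P}^{(1)}$ denotes the set of all partial computable functions from $\mathbb{N}$ to $\mathbb{N}$, and $\langle\cdot,\cdot\rangle$ is a fixed computable bijection from $\mathbb{N}^2$ to $\mathbb{N}$. A numbering of a set $\mathcal{A}$ is a surjective map $\nu\colon\mathbb{N}\to\mathcal{A}$. A numbering $\nu$ is reducible to a numbering $\mu$, written $\nu\leq\mu$, if there is a total computable function $f\colon\mathbb{N}\to\mathbb{N}$ with $\nu=\mu\circ f$. A numbering $\nu$ of a subset of $\mathcal{P}^{(1)}$ is computable if the partial function $(i,x)\mapsto\nu(i)(x)$ from $\mathbb{N}^2$ to $\mathbb{N}$ is partial computable. A Friedberg numbering is an injective computable numbering. A sequence $\{\nu_i\}_{i\in\mathbb{N}}$ of numberings of a subset of $\mathcal{P}^{(1)}$ is uniformly c.e. if the partial function $(i,n,x)\mapsto\nu_i(n)(x)$ from $\mathbb{N}^3$ to $\mathbb{N}$ is partial computable. The direct sum of a sequence $\{\mu_j\}_{j\in\mathbb{N}}$ of numberings of a set $\mathcal{A}$ is the numbering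 $\bigoplus_{j\in\mathbb{N}}\mu_j$ of $\mathcal{A}$ given by $\bigl(\bigoplus_{j\in\mathbb{N}}\mu_j\bigr)(\langle j,k\rangle)=\mu_j(k)$; the notation $\bigoplus_{j\neq i}\nu_j$ means the direct sum of the sequence $\nu_0,\ldots,\nu_{i-1},\nu_{i+1},\nu_{i+2},\ldots$ obtained by omitting $\nu_i$ and reindexing by $\mathbb{N}$ in increasing order. A sequence $\{\nu_i\}_{i\in\mathbb{N}}$ of numberings of a set is independent if $\nu_i\nleq\bigoplus_{j\neq i}\nu_j$ for all $i\in\mathbb{N}$. For $\mathcal{X},\mathcal{Y}\subseteq\mathcal{P}^{(1)}$, $\mathcal{Y}$ is strongly dense in $\mathcal{X}$ if every finite subfunction (restriction to a finite domain) of a member of $\mathcal{X}$ has infinitely many extensions in $\mathcal{Y}$. *)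

theory Defs
  imports Main "HOL-Library.Nat_Bijection"
begin

text \<open>Partial functions are of type \<open>nat \<Rightarrow> nat option\<close>, with \<^const>\<open>None\<close> for ``undefined''. Partial
  computability is defined through Kleene's \<open>\<mu>\<close>-recursive terms. Terms carry no arity: every
  term is evaluated on argument lists of any length, and a basic function or recursion applied to
  a list too short (or, for \<open>Succ\<close>, too long) for it is undefined there. Hence, for each fixed
  length \<open>k\<close>, the terms compute exactly the \<open>k\<close>-ary partial recursive functions.\<close>

datatype recf =
    Zero
  | Succ
  | Proj nat
  | Comp recf "recf list"
  | Prec recf recf
  | Mu recf

text \<open>Composition is strict in all arguments, and minimisation returns \<open>n\<close> only if the term is
  defined (and nonzero) at all smaller values.\<close>

fun reval :: "recf \<Rightarrow> nat list \<Rightarrow> nat option" where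
  "reval Zero xs = Some 0"
| "reval Succ xs = (case xs of [x] \<Rightarrow> Some (Suc x) | _ \<Rightarrow> None)"
| "reval (Proj i) xs = (if i < length xs then Some (xs ! i) else None)"
| "reval (Comp f gs) xs =
    (if \<exists>g\<in>set gs. reval g xs = None then None
     else reval f (map (\<lambda>g. the (reval g xs)) gs))"
| "reval (Prec f g) xs =
    (case xs of [] \<Rightarrow> None
     | n # ys \<Rightarrow> rec_nat (reval f ys)
                  (\<lambda>m r. case r of None \<Rightarrow> None | Some y \<Rightarrow> reval g (m # y # ys)) n)"
| "reval (Mu f) xs =
    (if \<exists>n. reval f (n # xs) = Some 0 \<and> (\<forall>m<n. reval f (m # xs) \<noteq> None)
     then Some (LEAST n. reval f (n # xs) = Some 0)
     else None)"

definition partial_computable1 :: "(nat \<Rightarrow> nat option) \<Rightarrow> bool" where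
  "partial_computable1 \<phi> \<longleftrightarrow> (\<exists>p. \<forall>x. reval p [x] = \<phi> x)"

definition partial_computable2 :: "(nat \<Rightarrow> nat \<Rightarrow> nat option) \<Rightarrow> bool" where
  "partial_computable2 \<phi> \<longleftrightarrow> (\<exists>p. \<forall>x y. reval p [x, y] = \<phi> x y)"

definition partial_computable3 :: "(nat \<Rightarrow> nat \<Rightarrow> nat \<Rightarrow> nat option) \<Rightarrow> bool" where
  "partial_computable3 \<phi> \<longleftrightarrow> (\<exists>p. \<forall>x y z. reval p [x, y, z] = \<phi> x y z)"

definition total_computable :: "(nat \<Rightarrow> nat) \<Rightarrow> bool" where
  "total_computable f \<longleftrightarrow> partial_computable1 (\<lambda>x. Some (f x))"

definition P1 :: "(nat \<Rightarrow> nat option) set" where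
  "P1 = {\<phi>. partial_computable1 \<phi>}"

definition numbering :: "'a set \<Rightarrow> (nat \<Rightarrow> 'a) \<Rightarrow> bool" where
  "numbering A \<nu> \<longleftrightarrow> range \<nu> = A"

definition reducible :: "(nat \<Rightarrow> 'a) \<Rightarrow> (nat \<Rightarrow> 'a) \<Rightarrow> bool" where
  "reducible \<nu> \<mu> \<longleftrightarrow> (\<exists>f. total_computable f \<and> \<nu> = \<mu> \<circ> f)"

definition computable_numbering ::
  "(nat \<Rightarrow> nat option) set \<Rightarrow> (nat \<Rightarrow> nat \<Rightarrow> nat option) \<Rightarrow> bool" where
  "computable_numbering A \<nu> \<longleftrightarrow> numbering A \<nu> \<and> partial_computable2 (\<lambda>i x. \<nu> i x)"

definition friedberg_numbering ::
  "(nat \<Rightarrow> nat option) set \<Rightarrow> (nat \<Rightarrow> nat \<Rightarrow> nat option) \<Rightarrow> bool" where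
  "friedberg_numbering A \<nu> \<longleftrightarrow> computable_numbering A \<nu> \<and> inj \<nu>"

definition uniformly_ce :: "(nat \<Rightarrow> nat \<Rightarrow> nat \<Rightarrow> nat option) \<Rightarrow> bool" where
  "uniformly_ce \<nu> \<longleftrightarrow> partial_computable3 (\<lambda>i n x. \<nu> i n x)"

text \<open>The fixed computable pairing bijection is Cantor's pairing \<^const>\<open>prod_encode\<close>; see
  \<open>bij_prod_encode\<close> and \<open>prod_encode_computable\<close> below.\<close>

definition direct_sum :: "(nat \<Rightarrow> nat \<Rightarrow> 'a) \<Rightarrow> nat \<Rightarrow> 'a" where
  "direct_sum \<mu> m = (case prod_decode m of (j, k) \<Rightarrow> \<mu> j k)"

definition omit :: "nat \<Rightarrow> (nat \<Rightarrow> 'a) \<Rightarrow> nat \<Rightarrow> 'a" where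
  "omit i \<nu> j = (if j < i then \<nu> j else \<nu> (Suc j))"

definition independent_seq :: "(nat \<Rightarrow> nat \<Rightarrow> 'a) \<Rightarrow> bool" where
  "independent_seq \<nu> \<longleftrightarrow> (\<forall>i. \<not> reducible (\<nu> i) (direct_sum (omit i \<nu>)))"

definition strongly_dense ::
  "(nat \<Rightarrow> nat option) set \<Rightarrow> (nat \<Rightarrow> nat option) set \<Rightarrow> bool" where
  "strongly_dense Y X \<longleftrightarrow>
    (\<forall>\<phi>\<in>X. \<forall>D. finite D \<longrightarrow> infinite {\<psi>\<in>Y. \<phi> |` D \<subseteq>\<^sub>m \<psi>})"

lemma direct_sum_prod_encode: "direct_sum \<mu> (prod_encode (j, k)) = \<mu> j k"
  by (simp add: direct_sum_def)

lemma prod_encode_computable: "partial_computable2 (\<lambda>x y. Some (prod_encode (x, y)))"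
proof -
  define add where "add = Prec (Proj 0) (Comp Succ [Proj 1])"
  have add: "reval add [x, y] = Some (x + y)" for x y
    by (induction x) (simp_all add: add_def)
  define tri where "tri = Prec Zero (Comp Succ [Comp add [Proj 0, Proj 1]])"
  have tri: "reval tri [x] = Some (triangle x)" for x
    by (induction x) (simp_all add: tri_def add)
  have "reval (Comp add [Comp tri [add], Proj 0]) [x, y] = Some (prod_encode (x, y))" for x y
    by (simp add: prod_encode_def add tri)
  then show ?thesis
    unfolding partial_computable2_def by blast
qed

end

theory Submission imports Defs begin

text \<open>Each \<open>\<nu> i\<close> is a Friedberg numbering built in the priority-free manner of Kummer. A family of
followers \<open>\<theta> n\<close>, all of them members of \<open>A \<union> C\<close>, is given together with a decidable test whether
\<open>n\<close> survives stage \<open>s\<close>. The index \<open>n\<close> of \<open>\<nu> i\<close> computes \<open>\<theta> n\<close> as long as \<open>n\<close> survives. If \<open>n\<close>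
dies, only a finite part of \<open>\<theta> n\<close> has been computed; by strong density infinitely many members of
\<open>B\<close> extend it, and \<open>n\<close> is given one that no other index has. When the surviving followers
enumerate \<open>A \<union> C\<close> without repetition, and infinitely many indices die at stage \<open>0\<close> (they are
free to take the least unused member of \<open>B\<close>), the result is an injective numbering of
\<open>A \<union> B \<union> C\<close>; injectivity uses that \<open>B\<close> is disjoint from \<open>A \<union> C\<close>. This is the locale
\<open>follower_system\<close>, with the outcome in \<open>inj_\<nu>\<close>, \<open>range_\<nu>\<close> and \<open>uniformly_ce_\<nu>\<close>.

For \<open>A\<close>, an index \<open>a\<close> of its numbering gets permanent followers only if it is the least index of
its function. This property is \<open>\<Sigma>\<^sub>2\<close>, so the followers are pairs of \<open>a\<close> and a guess at a witness,
and the guess can be made unique: a minimal \<open>a\<close> has exactly one surviving guess, any other \<open>a\<close>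
none (\<open>pi1_minimal_indices\<close>).

For \<open>C = {\<gamma> 0, \<gamma> 1, \<dots>}\<close>, the function \<open>\<gamma> k\<close> starts in every \<open>\<nu> i\<close> with the same index
\<open>anchor k\<close>. The pair \<open>k = \<langle>i, e\<rangle>\<close> is reserved for defeating the \<open>e\<close>-th partial computable function
\<open>f\<close> as a reduction of \<open>\<nu> i\<close> to the sum of the other \<open>\<nu> j\<close>. If \<open>f (anchor k)\<close> turns out to be
\<open>\<langle>j', anchor k\<rangle>\<close> for some \<open>j'\<close>, then \<open>anchor k\<close> dies in \<open>\<nu> i\<close>, and there only, so that it
names a member of \<open>B\<close> in \<open>\<nu> i\<close> but \<open>\<gamma> k\<close> in the numbering meant by \<open>j'\<close>; \<open>\<gamma> k\<close> is then followed
by another index of \<open>\<nu> i\<close>. In all other cases \<open>anchor k\<close> names \<open>\<gamma> k\<close> everywhere, and \<open>f\<close> is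
wrong because the numbering meant by \<open>j'\<close> is injective and has \<open>\<gamma> k\<close> at \<open>anchor k\<close> only
(\<open>independent_seqI\<close>). Since distinct requirements use distinct \<open>k\<close>, they never interfere.

Computability is handled through closure properties: predicates are shown to be decidable or
semidecidable by their syntactic shape, and a partial function with a semidecidable graph is
partial computable. Conversely a universal semidecidable evaluation relation for \<open>recf\<close> terms
(\<open>evaluates_iff\<close>) yields both the stagewise approximations of the given numberings and the
enumeration of all candidate reductions.\<close>

section \<open>Computable functions and decidable predicates of an environment\<close>

text \<open>An environment \<open>e\<close> assigns a value to every de Bruijn index: under a quantifier, \<open>e 0\<close> is the bound
variable and \<open>\<lambda>i. e (Suc i)\<close> the outer environment. A term only sees a finite prefix of \<open>e\<close>, and its
shape depends on the length of the prefix; requiring a term for all sufficiently large lengths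
lets two computable functions be brought to a common prefix.\<close>

definition computable :: "((nat \<Rightarrow> nat) \<Rightarrow> nat) \<Rightarrow> bool" where
  "computable F \<longleftrightarrow> (\<forall>\<^sub>F n in sequentially. \<exists>p. \<forall>e. reval p (map e [0..<n]) = Some (F e))"

definition decidable :: "((nat \<Rightarrow> nat) \<Rightarrow> bool) \<Rightarrow> bool" where
  "decidable P \<longleftrightarrow> computable (\<lambda>e. of_bool (\<not> P e))"

lemma computable_var: "computable (\<lambda>e. e i)"
  unfolding computable_def
proof (rule eventually_sequentiallyI[of "Suc i"])
  fix n assume "Suc i \<le> n"
  then have "reval (Proj i) (map e [0..<n]) = Some (e i)" for e by simp
  then show "\<exists>p. \<forall>e. reval p (map e [0..<n]) = Some (e i)" by blast
qed

lemma computable_subst: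
  assumes "computable F" and "\<And>i. computable (G i)"
  shows "computable (\<lambda>e. F (\<lambda>i. G i e))"
proof -
  obtain N p where p: "\<And>e. reval p (map e [0..<N]) = Some (F e)"
    using assms(1) unfolding computable_def eventually_sequentially by blast
  have "\<forall>\<^sub>F n in sequentially. \<forall>i\<in>{..<N}. \<exists>q. \<forall>e. reval q (map e [0..<n]) = Some (G i e)"
    using assms(2) unfolding computable_def by (intro eventually_ball_finite) auto
  then show ?thesis
    unfolding computable_def
  proof eventually_elim
    case (elim n)
    then obtain q where q: "\<And>i e. i < N \<Longrightarrow> reval (q i) (map e [0..<n]) = Some (G i e)"
      by (metis lessThan_iff)
    have "reval (Comp p (map q [0..<N])) (map e [0..<n]) = Some (F (\<lambda>i. G i e))" for e
    proof -
      have "map (\<lambda>g. the (reval g (map e [0..<n]))) (map q [0..<N]) = map (\<lambda>i. G i e) [0..<N]"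
        by (simp add: q)
      moreover have "\<not> (\<exists>g\<in>set (map q [0..<N]). reval g (map e [0..<n]) = None)"
        by (auto simp: q)
      ultimately show ?thesis
        using p[of "\<lambda>i. G i e"] by (simp only: reval.simps if_False)
    qed
    then show ?case by blast
  qed
qed

lemma computable_zero: "computable (\<lambda>e. 0)"
  unfolding computable_def by (intro always_eventually allI exI[of _ Zero]) simp

lemma map_case_nat_upt: "map (case_nat a e) [0..<Suc n] = a # map e [0..<n]"
  by (simp add: map_upt_Suc del: upt_Suc)

lemma computable_total1:
  assumes p: "\<And>x. reval p [x] = Some (g x)" and "computable F"
  shows "computable (\<lambda>e. g (F e))"
  using assms(2) unfolding computable_def
proof eventually_elim
  case (elim n)
  then obtain q where "\<And>e. reval q (map e [0..<n]) = Some (F e)" by blast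
  then have "\<And>e. reval (Comp p [q]) (map e [0..<n]) = Some (g (F e))" using p by simp
  then show ?case by blast
qed

lemma computable_total2:
  assumes p: "\<And>x y. reval p [x, y] = Some (g x y)" and "computable F" "computable G"
  shows "computable (\<lambda>e. g (F e) (G e))"
  using assms(2,3) unfolding computable_def
proof eventually_elim
  case (elim n)
  then obtain q r where "\<And>e. reval q (map e [0..<n]) = Some (F e)"
    and "\<And>e. reval r (map e [0..<n]) = Some (G e)" by blast
  then have "\<And>e. reval (Comp p [q, r]) (map e [0..<n]) = Some (g (F e) (G e))"
    using p by simp
  then show ?case by blast
qed

lemma computable_Suc:
  assumes "computable F" shows "computable (\<lambda>e. Suc (F e))"
  by (rule computable_total1[OF _ assms, of Succ]) simp

lemma computable_const: "computable (\<lambda>e. c)"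
proof (induction c)
  case 0
  show ?case by (rule computable_zero)
next
  case (Suc c)
  then show ?case by (rule computable_Suc)
qed

lemma computable_prod_encode:
  assumes "computable F" "computable G" shows "computable (\<lambda>e. prod_encode (F e, G e))"
proof -
  obtain p where p: "\<And>x y. reval p [x, y] = Some (prod_encode (x, y))"
    using prod_encode_computable unfolding partial_computable2_def by blast
  show ?thesis by (rule computable_total2[OF p assms])
qed

text \<open>Primitive recursion yields arithmetic, case distinctions and bounded search. Iterating the step function
with its two fresh arguments in front of the environment is exactly what \<open>Prec\<close> does.\<close>

lemma computable_rec_nat:
  assumes "computable A" and "computable (\<lambda>e. B (e 0) (e 1) (\<lambda>i. e (Suc (Suc i))))" and "computable C"
  shows "computable (\<lambda>e. rec_nat (A e) (\<lambda>m r. B m r e) (C e))"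
proof -
  have "\<forall>\<^sub>F n in sequentially. \<exists>p. \<forall>e. reval p (map e [0..<Suc (Suc n)]) =
      Some (B (e 0) (e 1) (\<lambda>i. e (Suc (Suc i))))"
    using assms(2) unfolding computable_def
    by (simp only: eventually_sequentially_Suc[where P="\<lambda>n. \<exists>p. \<forall>e. reval p (map e [0..<Suc n]) = _ e"]
         eventually_sequentially_Suc[where P="\<lambda>n. \<exists>p. \<forall>e. reval p (map e [0..<n]) = _ e"])
  with assms(1,3) show ?thesis unfolding computable_def
  proof eventually_elim
    case (elim n)
    then obtain a b c where a: "\<And>e. reval a (map e [0..<n]) = Some (A e)"
      and b: "\<And>e. reval b (map e [0..<Suc (Suc n)]) = Some (B (e 0) (e 1) (\<lambda>i. e (Suc (Suc i))))"
      and c: "\<And>e. reval c (map e [0..<n]) = Some (C e)" by blast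
    have b': "reval b (m # r # map e [0..<n]) = Some (B m r e)" for m r e
      using b[of "case_nat m (case_nat r e)"] unfolding map_case_nat_upt by simp
    have "reval (Prec a b) (k # map e [0..<n]) = Some (rec_nat (A e) (\<lambda>m r. B m r e) k)" for k e
      by (induction k) (simp_all add: a b')
    moreover have "reval (Proj i) (map e [0..<n]) = Some (e i)" if "i < n" for i e
      using that by simp
    then have "map (\<lambda>g. the (reval g (map e [0..<n]))) (c # map Proj [0..<n]) = C e # map e [0..<n]"
      and "\<not> (\<exists>g\<in>set (c # map Proj [0..<n]). reval g (map e [0..<n]) = None)" for e
      using c by (auto simp del: reval.simps)
    ultimately have "reval (Comp (Prec a b) (c # map Proj [0..<n])) (map e [0..<n]) =
        Some (rec_nat (A e) (\<lambda>m r. B m r e) (C e))" for e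
      by (simp only: reval.simps(4) if_False)
    then show ?case by blast
  qed
qed

lemma decidable_subst:
  assumes "decidable P" and "\<And>i. computable (G i)"
  shows "decidable (\<lambda>e. P (\<lambda>i. G i e))"
  using computable_subst[OF assms(1)[unfolded decidable_def] assms(2)] unfolding decidable_def .

lemma computable_if:
  assumes "decidable P" "computable F" "computable G"
  shows "computable (\<lambda>e. if P e then F e else G e)"
proof -
  have "computable (\<lambda>e. G (\<lambda>i. e (Suc (Suc i))))"
    by (rule computable_subst[OF assms(3), of "\<lambda>i e. e (Suc (Suc i))"]) (rule computable_var)
  then have "computable (\<lambda>e. rec_nat (F e) (\<lambda>m r. G e) (of_bool (\<not> P e)))"
    using assms unfolding decidable_def by (intro computable_rec_nat)
  moreover have "(\<lambda>e. rec_nat (F e) (\<lambda>m r. G e) (of_bool (\<not> P e))) = (\<lambda>e. if P e then F e else G e)"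
    by auto
  ultimately show ?thesis by simp
qed

lemma decidable_not:
  assumes "decidable P" shows "decidable (\<lambda>e. \<not> P e)"
  using computable_if[OF assms computable_const[of 1] computable_const[of 0]]
  by (simp add: decidable_def of_bool_def)

lemma decidable_conj:
  assumes "decidable P" "decidable Q" shows "decidable (\<lambda>e. P e \<and> Q e)"
proof -
  have "computable (\<lambda>e. if P e then of_bool (\<not> Q e) else 1)"
    using assms by (intro computable_if computable_const) (simp_all add: decidable_def)
  moreover have "(\<lambda>e. if P e then of_bool (\<not> Q e) else 1) = (\<lambda>e. of_bool (\<not> (P e \<and> Q e)) :: nat)"
    by auto
  ultimately show ?thesis by (simp add: decidable_def)
qed

lemma decidable_disj:
  assumes "decidable P" "decidable Q" shows "decidable (\<lambda>e. P e \<or> Q e)"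
  using decidable_not[OF decidable_conj[OF assms[THEN decidable_not]]] by simp

lemma decidable_imp:
  assumes "decidable P" "decidable Q" shows "decidable (\<lambda>e. P e \<longrightarrow> Q e)"
  using decidable_disj[OF decidable_not[OF assms(1)] assms(2)] by (simp only: imp_conv_disj)

lemma computable_pred:
  assumes "computable F" shows "computable (\<lambda>e. F e - 1)"
proof -
  have "rec_nat 0 (\<lambda>m r. m) k = k - 1" for k :: nat by (cases k) auto
  moreover have "computable (\<lambda>e. rec_nat 0 (\<lambda>m r. m) (F e))"
    by (intro computable_rec_nat computable_zero computable_var assms)
  ultimately show ?thesis by simp
qed

lemma computable_add:
  assumes "computable F" "computable G" shows "computable (\<lambda>e. F e + G e)"
proof -
  have "rec_nat a (\<lambda>m. Suc) k = a + k" for a k :: nat by (induction k) auto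
  moreover have "computable (\<lambda>e. rec_nat (F e) (\<lambda>m r. Suc r) (G e))"
    by (intro computable_rec_nat computable_Suc computable_var assms)
  ultimately show ?thesis by simp
qed

lemma decidable_le:
  assumes "computable F" "computable G" shows "decidable (\<lambda>e. F e \<le> G e)"
proof -
  have 1: "rec_nat a (\<lambda>m r. r - 1) k = a - k" for a k :: nat by (induction k) auto
  have 2: "rec_nat 0 (\<lambda>m r. 1) k = of_bool (k \<noteq> 0)" for k :: nat by (cases k) auto
  have "computable (\<lambda>e. rec_nat 0 (\<lambda>m r. 1) (rec_nat (F e) (\<lambda>m r. r - 1) (G e)))"
    by (intro computable_rec_nat computable_zero computable_const computable_pred computable_var assms)
  then have "computable (\<lambda>e. of_bool (F e - G e \<noteq> 0))" unfolding 1 2 .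
  moreover have "(F e - G e \<noteq> 0) = (\<not> F e \<le> G e)" for e by auto
  ultimately show ?thesis unfolding decidable_def by simp
qed

lemma decidable_less:
  assumes "computable F" "computable G" shows "decidable (\<lambda>e. F e < G e)"
  using decidable_not[OF decidable_le[OF assms(2,1)]] by (simp only: not_le)

lemma decidable_eq:
  assumes "computable F" "computable G" shows "decidable (\<lambda>e. F e = G e)"
  using decidable_conj[OF decidable_le[OF assms] decidable_le[OF assms(2,1)]]
  by (simp only: order_eq_iff[where 'a=nat])

lemma decidable_ex_less:
  assumes "computable F" and "decidable (\<lambda>e. P (e 0) (\<lambda>i. e (Suc i)))"
  shows "decidable (\<lambda>e. \<exists>y<F e. P y e)"
proof -
  have 1: "rec_nat 1 (\<lambda>m r. if P m e then 0 else r) k = of_bool (\<not> (\<exists>y<k. P y e))" for k :: nat and e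
    by (induction k) (auto simp: less_Suc_eq)
  have "computable (\<lambda>e. rec_nat 1 (\<lambda>m r. if P m e then 0 else r) (F e))"
  proof (intro computable_rec_nat computable_if computable_const computable_var assms(1))
    show "decidable (\<lambda>e. P (e 0) (\<lambda>i. e (Suc (Suc i))))"
      using decidable_subst[OF assms(2), of "\<lambda>i e. e (case i of 0 \<Rightarrow> 0 | Suc j \<Rightarrow> Suc (Suc j))"]
      by (simp add: computable_var)
  qed
  then show ?thesis unfolding 1 decidable_def .
qed

lemma decidable_all_less:
  assumes "computable F" and "decidable (\<lambda>e. P (e 0) (\<lambda>i. e (Suc i)))"
  shows "decidable (\<lambda>e. \<forall>y<F e. P y e)"
  using decidable_not[OF decidable_ex_less[OF assms(1) decidable_not[OF assms(2)]]] by simp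

lemma decidable_ex_le:
  assumes "computable F" and "decidable (\<lambda>e. P (e 0) (\<lambda>i. e (Suc i)))"
  shows "decidable (\<lambda>e. \<exists>y\<le>F e. P y e)"
  using decidable_ex_less[OF computable_Suc[OF assms(1)] assms(2)] by (simp add: less_Suc_eq_le)

lemma decidable_all_le:
  assumes "computable F" and "decidable (\<lambda>e. P (e 0) (\<lambda>i. e (Suc i)))"
  shows "decidable (\<lambda>e. \<forall>y\<le>F e. P y e)"
  using decidable_all_less[OF computable_Suc[OF assms(1)] assms(2)] by (simp add: less_Suc_eq_le)

lemma reval_Mu_total:
  assumes "\<And>y. reval p (y # xs) = Some (of_bool (\<not> P y))"
  shows "reval (Mu p) xs = (if \<exists>y. P y then Some (LEAST y. P y) else None)"
  using assms by simp

text \<open>Minimisation enters here: the value is the first \<open>y\<close> that passes the decidable test.\<close>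

lemma computable_graph:
  assumes "decidable (\<lambda>e. F (\<lambda>i. e (Suc i)) = e 0)"
  shows "computable F"
proof -
  have "\<forall>\<^sub>F n in sequentially. \<exists>p. \<forall>e. reval p (map e [0..<Suc n]) =
      Some (of_bool (\<not> (F (\<lambda>i. e (Suc i)) = e 0)))"
    using assms unfolding decidable_def computable_def
    by (simp only: eventually_sequentially_Suc[where P="\<lambda>n. \<exists>p. \<forall>e. reval p (map e [0..<n]) = _ e"])
  then show ?thesis unfolding computable_def
  proof eventually_elim
    case (elim n)
    then obtain p where p: "\<And>e. reval p (map e [0..<Suc n]) =
      Some (of_bool (\<not> (F (\<lambda>i. e (Suc i)) = e 0)))" by blast
    have "reval p (y # map e [0..<n]) = Some (of_bool (\<not> (F e = y)))" for y e
      using p[of "case_nat y e"] unfolding map_case_nat_upt by simp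
    then have "reval (Mu p) (map e [0..<n]) = Some (F e)" for e
      by (subst reval_Mu_total) (auto intro: Least_equality)
    then show ?case by blast
  qed
qed

lemma fst_prod_decode_graph: "fst (prod_decode z) = x \<longleftrightarrow> (\<exists>y\<le>z. prod_encode (x, y) = z)"
proof -
  obtain a b where "z = prod_encode (a, b)" by (metis prod.collapse prod_decode_inverse)
  then show ?thesis by (auto simp: prod_encode_eq le_prod_encode_2)
qed

lemma snd_prod_decode_graph: "snd (prod_decode z) = y \<longleftrightarrow> (\<exists>x\<le>z. prod_encode (x, y) = z)"
proof -
  obtain a b where "z = prod_encode (a, b)" by (metis prod.collapse prod_decode_inverse)
  then show ?thesis by (auto simp: prod_encode_eq le_prod_encode_1)
qed

lemma computable_fst:
  assumes "computable F" shows "computable (\<lambda>e. fst (prod_decode (F e)))"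
proof -
  have "decidable (\<lambda>e. \<exists>y\<le>e (Suc 0). prod_encode (e 0, y) = e (Suc 0))"
    by (intro decidable_ex_le decidable_eq computable_prod_encode computable_var)
  then have "computable (\<lambda>e. fst (prod_decode (e 0)))"
    by (intro computable_graph) (simp only: fst_prod_decode_graph)
  from computable_subst[OF this, of "\<lambda>i. F", OF assms] show ?thesis .
qed

lemma computable_snd:
  assumes "computable F" shows "computable (\<lambda>e. snd (prod_decode (F e)))"
proof -
  have "decidable (\<lambda>e. \<exists>x\<le>e (Suc 0). prod_encode (x, e 0) = e (Suc 0))"
    by (intro decidable_ex_le decidable_eq computable_prod_encode computable_var)
  then have "computable (\<lambda>e. snd (prod_decode (e 0)))"
    by (intro computable_graph) (simp only: snd_prod_decode_graph)
  from computable_subst[OF this, of "\<lambda>i. F", OF assms] show ?thesis .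
qed

lemmas computability_intros =
  computable_Suc computable_add computable_prod_encode computable_fst computable_snd computable_pred
  decidable_ex_less decidable_ex_le decidable_all_less decidable_all_le
  decidable_conj decidable_disj decidable_imp decidable_not decidable_le decidable_less decidable_eq
  computable_const computable_var

lemma decidable_subst3:
  assumes "decidable (\<lambda>e. P (e 0) (e 1) (e 2))" and "computable F" "computable G" "computable H"
  shows "decidable (\<lambda>e. P (F e) (G e) (H e))"
proof -
  define K where "K = case_nat F (case_nat G (\<lambda>_. H))"
  have "computable (K i)" for i using assms by (simp add: K_def split: nat.split)
  from decidable_subst[OF assms(1), of K, OF this] show ?thesis by (simp add: K_def numeral_2_eq_2)
qed

lemma decidable_subst4:
  assumes "decidable (\<lambda>e. P (e 0) (e 1) (e 2) (e 3))"
    and "computable F" "computable G" "computable H" "computable I"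
  shows "decidable (\<lambda>e. P (F e) (G e) (H e) (I e))"
proof -
  define K where "K = case_nat F (case_nat G (case_nat H (\<lambda>_. I)))"
  have "computable (K i)" for i using assms by (simp add: K_def split: nat.split)
  from decidable_subst[OF assms(1), of K, OF this] show ?thesis
    by (simp add: K_def numeral_2_eq_2 numeral_3_eq_3)
qed

section \<open>Semidecidable predicates\<close>

definition semidecidable :: "((nat \<Rightarrow> nat) \<Rightarrow> bool) \<Rightarrow> bool" where
  "semidecidable P \<longleftrightarrow> (\<exists>R. decidable R \<and> (\<forall>e. P e \<longleftrightarrow> (\<exists>w. R (case_nat w e))))"

lemma decidable_case_nat:
  assumes "decidable R" and "computable F" and "\<And>i. computable (G i)"
  shows "decidable (\<lambda>e. R (case_nat (F e) (\<lambda>i. G i e)))"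
proof -
  have "(\<lambda>i. case_nat F G i e) = case_nat (F e) (\<lambda>i. G i e)" for e
    by (auto split: nat.split)
  moreover have "decidable (\<lambda>e. R (\<lambda>i. case_nat F G i e))"
    by (rule decidable_subst[OF assms(1)]) (use assms in \<open>simp split: nat.split\<close>)
  ultimately show ?thesis by simp
qed

lemma semidecidable_decidable:
  assumes "decidable P" shows "semidecidable P"
proof -
  have "decidable (\<lambda>e. P (\<lambda>i. e (Suc i)))"
    by (rule decidable_subst[OF assms, of "\<lambda>i e. e (Suc i)"]) (rule computable_var)
  then show ?thesis
    unfolding semidecidable_def by (intro exI[of _ "\<lambda>e. P (\<lambda>i. e (Suc i))"]) simp
qed

lemma semidecidable_disj:
  assumes "semidecidable P" "semidecidable Q" shows "semidecidable (\<lambda>e. P e \<or> Q e)"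
proof -
  obtain R S where "decidable R" "decidable S"
    and "\<And>e. P e \<longleftrightarrow> (\<exists>w. R (case_nat w e))" "\<And>e. Q e \<longleftrightarrow> (\<exists>w. S (case_nat w e))"
    using assms unfolding semidecidable_def by blast
  then show ?thesis
    unfolding semidecidable_def
    by (intro exI[of _ "\<lambda>e. R e \<or> S e"] conjI decidable_disj) auto
qed

lemma semidecidable_conj:
  assumes "semidecidable P" "semidecidable Q" shows "semidecidable (\<lambda>e. P e \<and> Q e)"
proof -
  obtain R S where *: "decidable R" "decidable S"
    and PQ: "\<And>e. P e \<longleftrightarrow> (\<exists>w. R (case_nat w e))" "\<And>e. Q e \<longleftrightarrow> (\<exists>w. S (case_nat w e))"
    using assms unfolding semidecidable_def by blast
  define T where "T = (\<lambda>e. R (case_nat (fst (prod_decode (e 0))) (\<lambda>i. e (Suc i))) \<and>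
    S (case_nat (snd (prod_decode (e 0))) (\<lambda>i. e (Suc i))))"
  have "decidable T" unfolding T_def
    by (intro decidable_conj decidable_case_nat * computability_intros)
  moreover have "P e \<and> Q e \<longleftrightarrow> (\<exists>w. T (case_nat w e))" for e
  proof
    assume "P e \<and> Q e"
    then obtain v w where "R (case_nat v e)" "S (case_nat w e)" using PQ by blast
    then have "T (case_nat (prod_encode (v, w)) e)" by (simp add: T_def)
    then show "\<exists>w. T (case_nat w e)" ..
  qed (auto simp: T_def PQ)
  ultimately show ?thesis unfolding semidecidable_def by blast
qed

lemma semidecidable_ex:
  assumes "semidecidable (\<lambda>e. P (e 0) (\<lambda>i. e (Suc i)))"
  shows "semidecidable (\<lambda>e. \<exists>y. P y e)"
proof -
  obtain R where *: "decidable R"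
    and P: "\<And>e. P (e 0) (\<lambda>i. e (Suc i)) \<longleftrightarrow> (\<exists>w. R (case_nat w e))"
    using assms unfolding semidecidable_def by blast
  have P': "P y e \<longleftrightarrow> (\<exists>w. R (case_nat w (case_nat y e)))" for y e
    using P[of "case_nat y e"] by simp
  define T where "T = (\<lambda>e. R (case_nat (fst (prod_decode (e 0)))
    (\<lambda>i. case_nat (\<lambda>e. snd (prod_decode (e 0))) (\<lambda>i e. e (Suc i)) i e)))"
  have "decidable T" unfolding T_def
    by (rule decidable_case_nat[OF *]) (auto intro!: computability_intros split: nat.split)
  moreover have "(\<lambda>i. case_nat (\<lambda>e. snd (prod_decode (e 0))) (\<lambda>i e. e (Suc i)) i (case_nat w e)) =
      case_nat (snd (prod_decode w)) e" for w e
    by (auto split: nat.split)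
  then have T: "T (case_nat w e) = R (case_nat (fst (prod_decode w)) (case_nat (snd (prod_decode w)) e))"
    for w e by (simp add: T_def)
  have "(\<exists>y. P y e) \<longleftrightarrow> (\<exists>w. T (case_nat w e))" for e
  proof
    assume "\<exists>y. P y e"
    then obtain y w where "R (case_nat w (case_nat y e))" using P' by blast
    then have "T (case_nat (prod_encode (w, y)) e)" by (simp add: T)
    then show "\<exists>w. T (case_nat w e)" ..
  qed (auto simp: T P')
  ultimately show ?thesis unfolding semidecidable_def by blast
qed

text \<open>Finitely many witnesses have a common bound, so a bounded quantifier can be moved inside the
search for a witness.\<close>

lemma semidecidable_all_less:
  assumes "computable F" and "semidecidable (\<lambda>e. P (e 0) (\<lambda>i. e (Suc i)))"
  shows "semidecidable (\<lambda>e. \<forall>y<F e. P y e)"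
proof -
  obtain R where *: "decidable R"
    and P: "\<And>e. P (e 0) (\<lambda>i. e (Suc i)) \<longleftrightarrow> (\<exists>w. R (case_nat w e))"
    using assms unfolding semidecidable_def by blast
  have P': "P y e \<longleftrightarrow> (\<exists>w. R (case_nat w (case_nat y e)))" for y e
    using P[of "case_nat y e"] by simp
  define T where "T = (\<lambda>e. \<forall>y<F (\<lambda>i. e (Suc i)). \<exists>w<e 0. R (case_nat w (case_nat y (\<lambda>i. e (Suc i)))))"
  have 1: "(\<lambda>i. case_nat (\<lambda>e. e (Suc 0)) (\<lambda>i e. e (Suc (Suc (Suc i)))) i e) =
    case_nat (e (Suc 0)) (\<lambda>i. e (Suc (Suc (Suc i))))" for e :: "nat \<Rightarrow> nat"
    by (auto split: nat.split)
  have "decidable (\<lambda>e. R (case_nat (e 0)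
      (\<lambda>i. case_nat (\<lambda>e. e (Suc 0)) (\<lambda>i e. e (Suc (Suc (Suc i)))) i e)))"
    by (rule decidable_case_nat[OF *]) (auto intro!: computability_intros split: nat.split)
  then have "decidable T" unfolding T_def 1
    by (intro decidable_all_less decidable_ex_less computable_var
        computable_subst[OF assms(1), of "\<lambda>i e. e (Suc i)"])
  moreover have "(\<forall>y<F e. P y e) \<longleftrightarrow> (\<exists>w. T (case_nat w e))" for e
  proof
    assume "\<forall>y<F e. P y e"
    then have "\<forall>y. \<exists>w. y < F e \<longrightarrow> R (case_nat w (case_nat y e))"
      using P' by blast
    then obtain w where w: "\<And>y. y < F e \<Longrightarrow> R (case_nat (w y) (case_nat y e))"
      using choice[of "\<lambda>y w. y < F e \<longrightarrow> R (case_nat w (case_nat y e))"] by blast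
    have "w y < Suc (Max (w ` {..<F e}))" if "y < F e" for y
      using that by (simp add: less_Suc_eq_le)
    with w have "T (case_nat (Suc (Max (w ` {..<F e}))) e)" unfolding T_def by auto
    then show "\<exists>w. T (case_nat w e)" ..
  qed (auto simp: T_def P')
  ultimately show ?thesis unfolding semidecidable_def by blast
qed

lemma semidecidable_all_le:
  assumes "computable F" and "semidecidable (\<lambda>e. P (e 0) (\<lambda>i. e (Suc i)))"
  shows "semidecidable (\<lambda>e. \<forall>y\<le>F e. P y e)"
  using semidecidable_all_less[OF computable_Suc[OF assms(1)] assms(2)]
  by (simp add: less_Suc_eq_le)

lemma semidecidable_subst:
  assumes "semidecidable P" and "\<And>i. computable (G i)"
  shows "semidecidable (\<lambda>e. P (\<lambda>i. G i e))"
proof -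
  obtain R where *: "decidable R" and P: "\<And>e. P e \<longleftrightarrow> (\<exists>w. R (case_nat w e))"
    using assms unfolding semidecidable_def by blast
  have "decidable (\<lambda>e. R (case_nat (e 0) (\<lambda>i. G i (\<lambda>i. e (Suc i)))))"
    by (intro decidable_case_nat * computable_var
        computable_subst[OF assms(2), of "\<lambda>i e. e (Suc i)"])
  then show ?thesis unfolding semidecidable_def
    by (intro exI[of _ "\<lambda>e. R (case_nat (e 0) (\<lambda>i. G i (\<lambda>i. e (Suc i))))"]) (simp add: P)
qed

lemma semidecidable_subst3:
  assumes "semidecidable (\<lambda>e. P (e 0) (e 1) (e 2))"
    and "computable F" "computable G" "computable H"
  shows "semidecidable (\<lambda>e. P (F e) (G e) (H e))"
proof -
  define K where "K = case_nat F (case_nat G (\<lambda>_. H))"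
  have "computable (K i)" for i using assms by (simp add: K_def split: nat.split)
  from semidecidable_subst[OF assms(1), of K, OF this] show ?thesis
    by (simp add: K_def numeral_2_eq_2)
qed

text \<open>These two rules turn a semidecidable relation into a decidable one with an additional stage
argument, so that it can be approximated from below.\<close>

lemma semidecidable_witness2:
  assumes "semidecidable (\<lambda>e. P (e 0) (e 1))"
  obtains R where "decidable (\<lambda>e. R (e 0) (e 1) (e 2))" and "\<And>x y. P x y \<longleftrightarrow> (\<exists>w. R w x y)"
proof -
  obtain R where *: "decidable R" and P: "\<And>e. P (e 0) (e 1) \<longleftrightarrow> (\<exists>w. R (case_nat w e))"
    using assms unfolding semidecidable_def by blast
  define K :: "nat \<Rightarrow> (nat \<Rightarrow> nat) \<Rightarrow> nat"
    where "K = case_nat (\<lambda>e. e 0) (case_nat (\<lambda>e. e 1) (\<lambda>_ e. e 2))"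
  define Q where "Q w x y = R (\<lambda>i. K i (case_nat w (case_nat x (\<lambda>_. y))))" for w x y
  have K: "K i (case_nat w (case_nat x (\<lambda>_. y))) = case_nat w (case_nat x (\<lambda>_. y)) i" for i w x y
    by (simp add: K_def numeral_2_eq_2 split: nat.split)
  have "decidable (\<lambda>e. R (\<lambda>i. K i e))"
    by (rule decidable_subst[OF *]) (simp add: K_def computable_var split: nat.split)
  moreover have "R (\<lambda>i. K i e) = Q (e 0) (e 1) (e 2)" for e
    unfolding Q_def by (rule arg_cong[of _ _ R]) (auto simp: K_def numeral_2_eq_2 split: nat.split)
  ultimately have "decidable (\<lambda>e. Q (e 0) (e 1) (e 2))" by simp
  moreover have "P x y \<longleftrightarrow> (\<exists>w. Q w x y)" for x y
    using P[of "case_nat x (\<lambda>_. y)"] by (simp add: Q_def K)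
  ultimately show ?thesis using that by blast
qed

lemma semidecidable_witness3:
  assumes "semidecidable (\<lambda>e. P (e 0) (e 1) (e 2))"
  obtains R where "decidable (\<lambda>e. R (e 0) (e 1) (e 2) (e 3))" and "\<And>x y z. P x y z \<longleftrightarrow> (\<exists>w. R w x y z)"
proof -
  obtain R where *: "decidable R" and P: "\<And>e. P (e 0) (e 1) (e 2) \<longleftrightarrow> (\<exists>w. R (case_nat w e))"
    using assms unfolding semidecidable_def by blast
  define K :: "nat \<Rightarrow> (nat \<Rightarrow> nat) \<Rightarrow> nat"
    where "K = case_nat (\<lambda>e. e 0) (case_nat (\<lambda>e. e 1) (case_nat (\<lambda>e. e 2) (\<lambda>_ e. e 3)))"
  define Q where "Q w x y z = R (\<lambda>i. K i (case_nat w (case_nat x (case_nat y (\<lambda>_. z)))))" for w x y z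
  have K: "K i (case_nat w (case_nat x (case_nat y (\<lambda>_. z)))) =
      case_nat w (case_nat x (case_nat y (\<lambda>_. z))) i" for i w x y z
    by (simp add: K_def numeral_2_eq_2 numeral_3_eq_3 split: nat.split)
  have "decidable (\<lambda>e. R (\<lambda>i. K i e))"
    by (rule decidable_subst[OF *]) (simp add: K_def computable_var split: nat.split)
  moreover have "R (\<lambda>i. K i e) = Q (e 0) (e 1) (e 2) (e 3)" for e
    unfolding Q_def
    by (rule arg_cong[of _ _ R]) (auto simp: K_def numeral_2_eq_2 numeral_3_eq_3 split: nat.split)
  ultimately have "decidable (\<lambda>e. Q (e 0) (e 1) (e 2) (e 3))" by simp
  moreover have "P x y z \<longleftrightarrow> (\<exists>w. Q w x y z)" for x y z
    using P[of "case_nat x (case_nat y (\<lambda>_. z))"] by (simp add: Q_def K numeral_2_eq_2)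
  ultimately show ?thesis using that by blast
qed

lemmas semidecidability_intros =
  semidecidable_conj semidecidable_disj semidecidable_ex semidecidable_all_less
  semidecidable_all_le

text \<open>Searching for a pair of a witness and a value finds the value of the function, if there is one.
Semidecidability speaks of long prefixes of an environment; the last argument is repeated to
fill the prefix up.\<close>

lemma partial_computable3I:
  assumes "semidecidable (\<lambda>e. \<phi> (e 1) (e 2) (e 3) = Some (e 0))"
  shows "partial_computable3 \<phi>"
proof -
  obtain R where *: "decidable R"
    and R: "\<And>e. \<phi> (e 1) (e 2) (e 3) = Some (e 0) \<longleftrightarrow> (\<exists>w. R (case_nat w e))"
    using assms unfolding semidecidable_def by blast
  define S where "S = (\<lambda>e. R (case_nat (fst (prod_decode (e 0)))
    (\<lambda>i. case_nat (\<lambda>e. snd (prod_decode (e 0))) (\<lambda>i e. e (Suc i)) i e)))"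
  have "decidable S" unfolding S_def
    by (rule decidable_case_nat[OF *]) (auto intro!: computability_intros split: nat.split)
  then obtain N where N: "\<And>n. n \<ge> N \<Longrightarrow> \<exists>p. \<forall>e. reval p (map e [0..<n]) = Some (of_bool (\<not> S e))"
    unfolding decidable_def computable_def eventually_sequentially by blast
  obtain p where p: "\<And>e. reval p (map e [0..<Suc N]) = Some (of_bool (\<not> S e))"
    using N[of "Suc N"] by (auto simp del: upt_Suc)
  have "computable (\<lambda>e. snd (prod_decode (e 0)))" by (intro computability_intros)
  then obtain M q where q: "\<And>e. reval q (map e [0..<M]) = Some (snd (prod_decode (e 0)))"
    unfolding computable_def eventually_sequentially by blast
  define r where "r = Comp q (replicate M (Comp (Mu p) (map (\<lambda>i. Proj (min i 2)) [0..<N])))"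
  have "reval r [x, y, z] = \<phi> x y z" for x y z
  proof -
    define e where "e i = [x, y, z] ! min i 2" for i
    define Z where "Z v \<longleftrightarrow> S (case_nat v e)" for v
    have e: "e 0 = x" "e (Suc 0) = y" "e (Suc (Suc 0)) = z" by (simp_all add: e_def numeral_2_eq_2)
    have "(\<lambda>i. case_nat (\<lambda>e. snd (prod_decode (e 0))) (\<lambda>i e. e (Suc i)) i (case_nat v e)) =
        case_nat (snd (prod_decode v)) e" for v
      by (auto split: nat.split)
    then have Z: "Z v \<longleftrightarrow> R (case_nat (fst (prod_decode v)) (case_nat (snd (prod_decode v)) e))" for v
      by (simp add: Z_def S_def)
    have R': "\<phi> x y z = Some v \<longleftrightarrow> (\<exists>w. R (case_nat w (case_nat v e)))" for v
      using R[of "case_nat v e"] by (simp add: e numeral_2_eq_2 numeral_3_eq_3)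
    have "reval (Comp (Mu p) (map (\<lambda>i. Proj (min i 2)) [0..<N])) [x, y, z] =
        reval (Mu p) (map e [0..<N])"
    proof -
      have "reval (Proj (min i 2)) [x, y, z] = Some (e i)" for i by (simp add: e_def)
      then show ?thesis by (simp add: comp_def del: reval.simps(3) reval.simps(6))
    qed
    also have "reval p (v # map e [0..<N]) = Some (of_bool (\<not> Z v))" for v
      using p[of "case_nat v e"] unfolding map_case_nat_upt Z_def .
    then have "reval (Mu p) (map e [0..<N]) = (if \<exists>v. Z v then Some (LEAST v. Z v) else None)"
      by (rule reval_Mu_total)
    finally have s: "reval (Comp (Mu p) (map (\<lambda>i. Proj (min i 2)) [0..<N])) [x, y, z] =
      (if \<exists>v. Z v then Some (LEAST v. Z v) else None)" .
    show ?thesis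
    proof (cases "\<exists>v. Z v")
      case True
      define v where "v = (LEAST v. Z v)"
      have "Z v" unfolding v_def using True by (rule LeastI_ex)
      then have "\<phi> x y z = Some (snd (prod_decode v))" using Z R' by blast
      moreover have "map (\<lambda>_. v) [0..<M] = replicate M v" by (simp add: map_replicate_const)
      then have "reval q (replicate M v) = Some (snd (prod_decode v))" using q[of "\<lambda>_. v"] by simp
      ultimately show ?thesis unfolding r_def using s True
        by (simp add: v_def[symmetric] del: reval.simps(3) reval.simps(6))
    next
      case False
      have "\<phi> x y z \<noteq> Some v" for v
      proof
        assume "\<phi> x y z = Some v"
        then obtain w where "R (case_nat w (case_nat v e))" using R' by blast
        then have "Z (prod_encode (w, v))" by (simp add: Z)
        with False show False by blast
      qed
      then have "\<phi> x y z = None" by auto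
      \<comment> \<open>With no argument at all, the composition would not notice that the search diverges.\<close>
      moreover have "M \<noteq> 0"
      proof
        assume "M = 0"
        then have "snd (prod_decode 0) = snd (prod_decode 1)"
          using q[of "\<lambda>_. 0"] q[of "\<lambda>_. 1"] by simp
        moreover have "snd (prod_decode (prod_encode (0, 0))) \<noteq> snd (prod_decode (prod_encode (0, 1)))"
          by simp
        ultimately show False by (simp add: prod_encode_def)
      qed
      ultimately show ?thesis unfolding r_def using s False
        by (simp del: reval.simps(3) reval.simps(6))
    qed
  qed
  then show ?thesis unfolding partial_computable3_def by blast
qed

section \<open>A universal semidecidable relation\<close>

text \<open>List codes, addressed by position. Dropping \<open>n\<close> elements is primitive recursive on codes,
because \<open>0\<close> codes the empty list and \<open>prod_decode 0 = (0, 0)\<close>.\<close>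

definition entry :: "nat \<Rightarrow> nat \<Rightarrow> nat" where
  "entry c n = fst (prod_decode (rec_nat c (\<lambda>m r. snd (prod_decode (r - 1))) n - 1))"

definition code_length :: "nat \<Rightarrow> nat" where
  "code_length c = length (list_decode c)"

lemma prod_decode_0: "prod_decode 0 = (0, 0)"
  using prod_encode_inverse[of "(0, 0)"] by (simp add: prod_encode_def)

lemma drop_code: "rec_nat (list_encode xs) (\<lambda>m r. snd (prod_decode (r - 1))) n = list_encode (drop n xs)"
proof (induction n)
  case (Suc n)
  have tl: "snd (prod_decode (list_encode ys - 1)) = list_encode (tl ys)" for ys
    by (cases ys) (simp_all add: prod_decode_0)
  have "rec_nat (list_encode xs) (\<lambda>m r. snd (prod_decode (r - 1))) (Suc n) =
      snd (prod_decode (list_encode (drop n xs) - 1))"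
    using Suc by simp
  also have "\<dots> = list_encode (drop (Suc n) xs)" unfolding tl by (simp add: tl_drop drop_Suc)
  finally show ?case .
qed simp

lemma entry_list_encode: "n < length xs \<Longrightarrow> entry (list_encode xs) n = xs ! n"
  unfolding entry_def drop_code by (simp add: Cons_nth_drop_Suc[symmetric])

lemma code_length_list_encode: "code_length (list_encode xs) = length xs"
  by (simp add: code_length_def)

lemma computable_entry:
  assumes "computable F" "computable G" shows "computable (\<lambda>e. entry (F e) (G e))"
  unfolding entry_def
  by (intro computable_fst computable_pred computable_rec_nat computable_snd computable_var assms)

lemma code_length_graph:
  "code_length c = n \<longleftrightarrow> rec_nat c (\<lambda>m r. snd (prod_decode (r - 1))) n = 0 \<and>
    (\<forall>k<n. rec_nat c (\<lambda>m r. snd (prod_decode (r - 1))) k \<noteq> 0)"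
proof -
  obtain xs where xs: "c = list_encode xs" by (metis list_decode_inverse)
  have "list_encode ys = 0 \<longleftrightarrow> ys = []" for ys by (cases ys) auto
  then have "list_encode (drop k xs) = 0 \<longleftrightarrow> length xs \<le> k" for k by simp
  moreover have "length xs = n \<longleftrightarrow> length xs \<le> n \<and> (\<forall>k<n. \<not> length xs \<le> k)"
    by (metis le_eq_less_or_eq linorder_not_less order_refl)
  ultimately show ?thesis unfolding xs drop_code code_length_list_encode by simp
qed

lemma computable_code_length:
  assumes "computable F" shows "computable (\<lambda>e. code_length (F e))"
proof -
  have "decidable (\<lambda>e. code_length (e (Suc 0)) = e 0)"
    unfolding code_length_graph
    by (intro computability_intros computable_rec_nat)
  then have "computable (\<lambda>e. code_length (e 0))" by (rule computable_graph)
  from computable_subst[OF this, of "\<lambda>i. F", OF assms] show ?thesis .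
qed

fun recf_code :: "recf \<Rightarrow> nat" where
  "recf_code Zero = prod_encode (0, 0)"
| "recf_code Succ = prod_encode (1, 0)"
| "recf_code (Proj i) = prod_encode (2, i)"
| "recf_code (Comp f gs) = prod_encode (3, prod_encode (recf_code f, list_encode (map recf_code gs)))"
| "recf_code (Prec f g) = prod_encode (4, prod_encode (recf_code f, recf_code g))"
| "recf_code (Mu f) = prod_encode (5, recf_code f)"

text \<open>One step of the evaluation calculus. A fact \<open>(c, x, y)\<close> says that the term with code \<open>c\<close> has
value \<open>y\<close> on the arguments coded by \<open>x\<close>; it is justified by facts in \<open>S\<close>. The predicate \<open>S\<close>
occurs only positively, and universal quantifiers are bounded, whence justification by a finite
set of facts is semidecidable.\<close>

definition justified :: "(nat \<Rightarrow> nat \<Rightarrow> nat \<Rightarrow> bool) \<Rightarrow> nat \<Rightarrow> nat \<Rightarrow> nat \<Rightarrow> bool" where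
  "justified S c x y \<longleftrightarrow>
     (c = prod_encode (0, 0) \<and> y = 0)
   \<or> (c = prod_encode (1, 0) \<and> (\<exists>a. x = Suc (prod_encode (a, 0)) \<and> y = Suc a))
   \<or> (\<exists>i. c = prod_encode (2, i) \<and> i < code_length x \<and> y = entry x i)
   \<or> (\<exists>f gs ys. c = prod_encode (3, prod_encode (f, gs)) \<and> code_length ys = code_length gs \<and>
        (\<forall>j<code_length gs. S (entry gs j) x (entry ys j)) \<and> S f ys y)
   \<or> (\<exists>f g ys. c = prod_encode (4, prod_encode (f, g)) \<and> x = Suc (prod_encode (0, ys)) \<and> S f ys y)
   \<or> (\<exists>f g m ys r. c = prod_encode (4, prod_encode (f, g)) \<and> x = Suc (prod_encode (Suc m, ys)) \<and>
        S c (Suc (prod_encode (m, ys))) r \<and>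
        S g (Suc (prod_encode (m, Suc (prod_encode (r, ys))))) y)
   \<or> (\<exists>f. c = prod_encode (5, f) \<and> S f (Suc (prod_encode (y, x))) 0 \<and>
        (\<forall>j<y. \<exists>r. S f (Suc (prod_encode (j, x))) (Suc r)))"

text \<open>A derivation is a coded sequence of facts each of which is justified by earlier ones. The
ordering of the sequence excludes circular justifications.\<close>

definition fact_in :: "nat \<Rightarrow> nat \<Rightarrow> nat \<Rightarrow> nat \<Rightarrow> nat \<Rightarrow> bool" where
  "fact_in d i c x y \<longleftrightarrow> (\<exists>k<i. entry d k = prod_encode (c, prod_encode (x, y)))"

definition derivation :: "nat \<Rightarrow> nat \<Rightarrow> bool" where
  "derivation d n \<longleftrightarrow> (\<forall>i<n. \<exists>c x y. entry d i = prod_encode (c, prod_encode (x, y)) \<and>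
     justified (fact_in d i) c x y)"

definition evaluates :: "nat \<Rightarrow> nat \<Rightarrow> nat \<Rightarrow> bool" where
  "evaluates c x y \<longleftrightarrow> (\<exists>d n. derivation d n \<and> fact_in d n c x y)"

lemma semidecidable_evaluates: "semidecidable (\<lambda>e. evaluates (e 0) (e 1) (e 2))"
  unfolding evaluates_def derivation_def justified_def fact_in_def
  by (rule semidecidability_intros semidecidable_decidable computable_entry computable_code_length
      computability_intros)+

lemma justified_mono:
  assumes "justified S c x y" and "\<And>c x y. S c x y \<Longrightarrow> T c x y"
  shows "justified T c x y"
  using assms(1) unfolding justified_def
  by (elim disj_forward conj_forward ex_forward all_forward imp_forward) (auto intro: assms(2))

text \<open>Evaluation is a function, so justified facts are true as soon as the facts used are.\<close>

lemma justified_sound: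
  assumes "justified S (recf_code p) (list_encode xs) y"
    and S: "\<And>p xs y. S (recf_code p) (list_encode xs) y \<Longrightarrow> reval p xs = Some y"
  shows "reval p xs = Some y"
proof (cases p)
  case Zero
  then show ?thesis using assms(1) by (auto simp: justified_def prod_encode_eq)
next
  case Succ
  then obtain a where "list_encode xs = list_encode [a]" "y = Suc a"
    using assms(1) by (auto simp: justified_def prod_encode_eq)
  then show ?thesis using Succ by (simp only: list_encode_eq) simp
next
  case (Proj i)
  then show ?thesis
    using assms(1)
    by (auto simp: justified_def prod_encode_eq code_length_list_encode entry_list_encode)
next
  case (Comp f gs)
  then obtain z where z: "code_length z = length gs"
    "\<And>j. j < length gs \<Longrightarrow> S (recf_code (gs ! j)) (list_encode xs) (entry z j)" "S (recf_code f) z y"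
    using assms(1)
    by (auto simp: justified_def prod_encode_eq code_length_list_encode entry_list_encode)
  obtain ys where ys: "z = list_encode ys" by (metis list_decode_inverse)
  have len: "length ys = length gs" using z(1) by (simp add: ys code_length_list_encode)
  have g: "reval (gs ! j) xs = Some (ys ! j)" if "j < length gs" for j
    using S[OF z(2)[OF that]] that len by (simp add: ys entry_list_encode)
  have "map (\<lambda>g. the (reval g xs)) gs = ys"
    by (rule nth_equalityI) (simp_all add: len g)
  moreover have "\<not> (\<exists>g\<in>set gs. reval g xs = None)" by (auto simp: in_set_conv_nth g)
  ultimately show ?thesis using S z(3) by (simp add: Comp ys)
next
  case (Prec f g)
  then consider z where "list_encode xs = Suc (prod_encode (0, z))" "S (recf_code f) z y"
    | m z r where "list_encode xs = Suc (prod_encode (Suc m, z))"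
      "S (recf_code p) (Suc (prod_encode (m, z))) r"
      "S (recf_code g) (Suc (prod_encode (m, Suc (prod_encode (r, z))))) y"
    using assms(1) unfolding justified_def by (force simp: prod_encode_eq)
  then show ?thesis
  proof cases
    case 1
    obtain ys where ys: "z = list_encode ys" by (metis list_decode_inverse)
    then have "list_encode xs = list_encode (0 # ys)" using 1 by simp
    then have "xs = 0 # ys" by (simp only: list_encode_eq)
    then show ?thesis using S 1(2) by (simp add: Prec ys)
  next
    case 2
    obtain ys where ys: "z = list_encode ys" by (metis list_decode_inverse)
    then have "list_encode xs = list_encode (Suc m # ys)" using 2 by simp
    then have xs: "xs = Suc m # ys" by (simp only: list_encode_eq)
    have "reval p (m # ys) = Some r" by (rule S) (use 2(2) in \<open>simp add: ys\<close>)
    moreover have "reval g (m # r # ys) = Some y" by (rule S) (use 2(3) in \<open>simp add: ys\<close>)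
    ultimately show ?thesis by (simp add: Prec xs)
  qed
next
  case (Mu f)
  then have "S (recf_code f) (list_encode (y # xs)) 0"
    and "\<forall>j<y. \<exists>r. S (recf_code f) (list_encode (j # xs)) (Suc r)"
    using assms(1) by (auto simp: justified_def prod_encode_eq)
  then have y: "reval f (y # xs) = Some 0"
    and less: "\<And>j. j < y \<Longrightarrow> \<exists>r. reval f (j # xs) = Some (Suc r)"
    using S by blast+
  have "(LEAST n. reval f (n # xs) = Some 0) = y"
  proof (rule Least_equality)
    fix n assume "reval f (n # xs) = Some 0"
    then show "y \<le> n" using less[of n] by (cases "n < y") auto
  qed (rule y)
  moreover have "\<exists>n. reval f (n # xs) = Some 0 \<and> (\<forall>m<n. reval f (m # xs) \<noteq> None)"
    using y less by (metis option.distinct(1))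
  ultimately show ?thesis by (simp add: Mu)
qed

lemma evaluates_sound:
  assumes "evaluates (recf_code p) (list_encode xs) y" shows "reval p xs = Some y"
proof -
  obtain d n where d: "derivation d n" and *: "fact_in d n (recf_code p) (list_encode xs) y"
    using assms unfolding evaluates_def by blast
  have "i \<le> n \<Longrightarrow> fact_in d i (recf_code p) (list_encode xs) y \<Longrightarrow> reval p xs = Some y" for i p xs y
  proof (induction i arbitrary: p xs y rule: less_induct)
    case (less i)
    then obtain k where k: "k < i" "entry d k = prod_encode (recf_code p, prod_encode (list_encode xs, y))"
      unfolding fact_in_def by blast
    then have "justified (fact_in d k) (recf_code p) (list_encode xs) y"
      using d less.prems(1) unfolding derivation_def
      by (metis (no_types, lifting) fst_conv order_less_le_trans prod_encode_inverse snd_conv)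
    then show ?case
      by (rule justified_sound) (use less k(1) in auto)
  qed
  then show ?thesis using * by blast
qed

text \<open>Completeness is proved with uncoded derivations, which can simply be concatenated.\<close>

definition good :: "(nat \<times> nat \<times> nat) list \<Rightarrow> bool" where
  "good L \<longleftrightarrow> (\<forall>i<length L. case L ! i of (c, x, y) \<Rightarrow>
     justified (\<lambda>c x y. (c, x, y) \<in> set (take i L)) c x y)"

lemma good_append:
  assumes "good L" "good M" shows "good (L @ M)"
  unfolding good_def
proof (intro allI impI)
  fix i assume i: "i < length (L @ M)"
  obtain c x y where cxy: "(L @ M) ! i = (c, x, y)" by (metis prod_cases3)
  have "justified (\<lambda>c x y. (c, x, y) \<in> set (take i (L @ M))) c x y"
  proof (cases "i < length L")
    case True
    then show ?thesis using assms(1) cxy unfolding good_def by (fastforce simp: nth_append)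
  next
    case False
    then have "justified (\<lambda>c x y. (c, x, y) \<in> set (take (i - length L) M)) c x y"
      using assms(2) cxy i unfolding good_def
      by (fastforce simp: nth_append dest: spec[of _ "i - length L"])
    then show ?thesis by (rule justified_mono) simp
  qed
  then show "case (L @ M) ! i of (c, x, y) \<Rightarrow>
     justified (\<lambda>c x y. (c, x, y) \<in> set (take i (L @ M))) c x y" by (simp add: cxy)
qed

lemma good_evaluates:
  assumes "good L" "(c, x, y) \<in> set L" shows "evaluates c x y"
proof -
  define enc where "enc = (\<lambda>(c :: nat, x :: nat, y :: nat). prod_encode (c, prod_encode (x, y)))"
  define d where "d = list_encode (map enc L)"
  have entry: "entry d i = enc (L ! i)" if "i < length L" for i
    using that by (simp add: d_def entry_list_encode)
  have fact: "fact_in d i c x y \<longleftrightarrow> (c, x, y) \<in> set (take i L)" if "i \<le> length L" for i c x y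
  proof -
    have "fact_in d i c x y \<longleftrightarrow> (\<exists>k<i. L ! k = (c, x, y))"
      unfolding fact_in_def
    proof (intro ex_cong1 conj_cong refl)
      fix k assume "k < i"
      then show "entry d k = prod_encode (c, prod_encode (x, y)) \<longleftrightarrow> L ! k = (c, x, y)"
        using that by (cases "L ! k") (simp add: entry enc_def prod_encode_eq)
    qed
    then show ?thesis using that by (auto simp: in_set_conv_nth)
  qed
  have "derivation d (length L)"
    unfolding derivation_def
  proof (intro allI impI)
    fix i assume i: "i < length L"
    obtain c x y where cxy: "L ! i = (c, x, y)" by (metis prod_cases3)
    then have "justified (fact_in d i) c x y"
      using assms(1) i fact[of i] unfolding good_def by (fastforce elim: justified_mono)
    then show "\<exists>c x y. entry d i = prod_encode (c, prod_encode (x, y)) \<and> justified (fact_in d i) c x y"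
      using entry[OF i] cxy by (auto simp: enc_def)
  qed
  moreover have "fact_in d (length L) c x y" using fact[of "length L"] assms(2) by simp
  ultimately show ?thesis unfolding evaluates_def by blast
qed

definition provable :: "nat \<Rightarrow> nat \<Rightarrow> nat \<Rightarrow> bool" where
  "provable c x y \<longleftrightarrow> (\<exists>L. good L \<and> (c, x, y) \<in> set L)"

lemma finite_provable:
  assumes "finite F" and "\<And>c x y. (c, x, y) \<in> F \<Longrightarrow> provable c x y"
  shows "\<exists>L. good L \<and> F \<subseteq> set L"
  using assms
proof (induction F rule: finite_induct)
  case empty
  show ?case by (intro exI[of _ "[]"]) (simp add: good_def)
next
  case (insert t F)
  then obtain L where "good L" "F \<subseteq> set L" by blast
  moreover obtain M where "good M" "t \<in> set M"
    using insert.prems unfolding provable_def by (metis insertI1 prod_cases3)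
  ultimately have "good (L @ M)" "insert t F \<subseteq> set (L @ M)" by (auto intro: good_append)
  then show ?case by blast
qed

text \<open>The calculus is finitary: derivations of finitely many premises fit into a single one.\<close>

lemma provable_justified:
  assumes "finite F" and "\<And>c x y. (c, x, y) \<in> F \<Longrightarrow> provable c x y"
    and "justified (\<lambda>c x y. (c, x, y) \<in> F) c x y"
  shows "provable c x y"
proof -
  obtain L where L: "good L" "F \<subseteq> set L" using finite_provable[OF assms(1,2)] by blast
  have "justified (\<lambda>c x y. (c, x, y) \<in> set L) c x y"
    using assms(3) by (rule justified_mono) (use L(2) in blast)
  then have "good (L @ [(c, x, y)])"
    using L(1) unfolding good_def by (auto simp: nth_append less_Suc_eq)
  then show ?thesis unfolding provable_def by fastforce
qed

lemma reval_provable: "reval p xs = Some y \<Longrightarrow> provable (recf_code p) (list_encode xs) y"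
proof (induction p arbitrary: xs y)
  case Zero
  show ?case by (rule provable_justified[of "{}"]) (use Zero in \<open>auto simp: justified_def\<close>)
next
  case Succ
  then obtain a where "xs = [a]" "y = Suc a" by (auto split: list.splits)
  then show ?case
    by - (rule provable_justified[of "{}"], simp_all add: justified_def prod_encode_eq)
next
  case (Proj i)
  then have "i < length xs" "y = xs ! i" by (auto split: if_splits)
  then show ?case
    by - (rule provable_justified[of "{}"],
      simp_all add: justified_def prod_encode_eq entry_list_encode code_length_list_encode)
next
  case (Comp f gs)
  have gs: "\<And>g. g \<in> set gs \<Longrightarrow> reval g xs \<noteq> None"
    and f: "reval f (map (\<lambda>g. the (reval g xs)) gs) = Some y"
    using Comp.prems by (auto split: if_splits)
  define ys where "ys = map (\<lambda>g. the (reval g xs)) gs"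
  define F where "F = insert (recf_code f, list_encode ys, y)
    ((\<lambda>g. (recf_code g, list_encode xs, the (reval g xs))) ` set gs)"
  show ?case
  proof (rule provable_justified[of F])
    show "finite F" by (simp add: F_def)
    show "provable c x z" if "(c, x, z) \<in> F" for c x z
      using that unfolding F_def ys_def
      by (auto intro: Comp.IH(1) f) (metis Comp.IH(2) gs option.exhaust_sel)
    have "code_length (list_encode ys) = code_length (list_encode (map recf_code gs))"
      by (simp add: code_length_list_encode ys_def)
    moreover have "\<forall>j<code_length (list_encode (map recf_code gs)).
      (entry (list_encode (map recf_code gs)) j, list_encode xs, entry (list_encode ys) j) \<in> F"
      by (auto simp: code_length_list_encode entry_list_encode ys_def F_def)
    moreover have "(recf_code f, list_encode ys, y) \<in> F" by (simp add: F_def)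
    ultimately show "justified (\<lambda>c x y. (c, x, y) \<in> F) (recf_code (Comp f gs)) (list_encode xs) y"
      unfolding justified_def recf_code.simps by blast
  qed
next
  case (Prec f g)
  then obtain n ys where xs: "xs = n # ys" by (auto split: list.splits)
  have "reval (Prec f g) (n # ys) = Some y \<Longrightarrow>
      provable (recf_code (Prec f g)) (list_encode (n # ys)) y" for y
  proof (induction n arbitrary: y)
    case 0
    show ?case
      by (rule provable_justified[of "{(recf_code f, list_encode ys, y)}"])
         (use 0 Prec.IH(1) in \<open>auto simp: justified_def prod_encode_eq\<close>)
  next
    case (Suc m)
    then obtain r where r: "reval (Prec f g) (m # ys) = Some r" "reval g (m # r # ys) = Some y"
      by (auto split: option.splits)
    show ?case
    proof (rule provable_justified[of "{(recf_code (Prec f g), list_encode (m # ys), r),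
        (recf_code g, list_encode (m # r # ys), y)}"])
      show "provable c x z" if "(c, x, z) \<in> {(recf_code (Prec f g), list_encode (m # ys), r),
        (recf_code g, list_encode (m # r # ys), y)}" for c x z
        using that Suc.IH[OF r(1)] Prec.IH(2)[OF r(2)] by auto
    qed (simp_all add: justified_def prod_encode_eq, blast)
  qed
  then show ?case using Prec.prems by (simp only: xs)
next
  case (Mu f)
  have ex: "\<exists>n. reval f (n # xs) = Some 0 \<and> (\<forall>m<n. reval f (m # xs) \<noteq> None)"
    and y: "y = (LEAST n. reval f (n # xs) = Some 0)"
    using Mu.prems by (auto split: if_splits)
  obtain n where n: "reval f (n # xs) = Some 0" "\<forall>m<n. reval f (m # xs) \<noteq> None" using ex by blast
  have y0: "reval f (y # xs) = Some 0" unfolding y by (rule LeastI[of "\<lambda>n. reval f (n # xs) = Some 0", OF n(1)])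
  have "y \<le> n" unfolding y by (rule Least_le[of "\<lambda>n. reval f (n # xs) = Some 0", OF n(1)])
  have less: "\<exists>r. reval f (j # xs) = Some (Suc r)" if "j < y" for j
  proof -
    have "reval f (j # xs) \<noteq> Some 0" using that not_less_Least unfolding y by blast
    moreover have "reval f (j # xs) \<noteq> None" using n(2) \<open>y \<le> n\<close> that by simp
    ultimately show ?thesis by (metis not0_implies_Suc option.exhaust)
  qed
  define F where "F = insert (recf_code f, list_encode (y # xs), 0)
    ((\<lambda>j. (recf_code f, list_encode (j # xs), the (reval f (j # xs)))) ` {..<y})"
  show ?case
  proof (rule provable_justified[of F])
    show "finite F" by (simp add: F_def)
    show "provable c x z" if "(c, x, z) \<in> F" for c x z
    proof -
      have "provable (recf_code f) (list_encode (j # xs)) (the (reval f (j # xs)))" if "j < y" for j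
        using Mu.IH less[OF that] by fastforce
      then show ?thesis using that Mu.IH[OF y0] unfolding F_def by auto
    qed
    have "(recf_code f, Suc (prod_encode (y, list_encode xs)), 0) \<in> F" by (simp add: F_def)
    moreover have "\<exists>r. (recf_code f, Suc (prod_encode (j, list_encode xs)), Suc r) \<in> F" if j: "j < y" for j
    proof -
      obtain r where "reval f (j # xs) = Some (Suc r)" using less[OF j] by blast
      then have "(recf_code f, Suc (prod_encode (j, list_encode xs)), Suc r) \<in> F"
        unfolding F_def using j by (intro insertI2 image_eqI[of _ _ j]) auto
      then show ?thesis ..
    qed
    ultimately show "justified (\<lambda>c x y. (c, x, y) \<in> F) (recf_code (Mu f)) (list_encode xs) y"
      unfolding justified_def recf_code.simps by blast
  qed
qed

lemma evaluates_iff: "evaluates (recf_code p) (list_encode xs) y \<longleftrightarrow> reval p xs = Some y"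
  using evaluates_sound reval_provable good_evaluates unfolding provable_def by blast

text \<open>Specialising the universal relation to a single term gives the graph of the function that the
term computes.\<close>

lemma semidecidable_partial_computable2:
  assumes "partial_computable2 \<phi>" shows "semidecidable (\<lambda>e. \<phi> (e 0) (e 1) = Some (e 2))"
proof -
  obtain p where p: "\<And>x y. reval p [x, y] = \<phi> x y"
    using assms unfolding partial_computable2_def by blast
  have "semidecidable (\<lambda>e. evaluates (recf_code p)
      (Suc (prod_encode (e 0, Suc (prod_encode (e 1, 0))))) (e 2))"
    by (rule semidecidable_subst3[OF semidecidable_evaluates]) (intro computability_intros)+
  moreover have "evaluates (recf_code p) (Suc (prod_encode (x, Suc (prod_encode (y, 0))))) z \<longleftrightarrow>
      \<phi> x y = Some z" for x y z
    using evaluates_iff[of p "[x, y]" z] p by simp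
  ultimately show ?thesis by simp
qed

section \<open>Friedberg numberings from followers\<close>

text \<open>\<open>V i n s\<close> says that index \<open>n\<close> of the \<open>i\<close>-th numbering survives stage \<open>s\<close>. \<open>R\<close> and \<open>T\<close> enumerate
the graphs of \<open>\<theta>\<close> and \<open>\<beta>\<close>. The indices failing at stage \<open>0\<close> make sure that the whole range of
\<open>\<beta>\<close> gets used.\<close>

locale follower_system =
  fixes \<theta> \<beta> :: "nat \<Rightarrow> nat \<Rightarrow> nat option"
    and V :: "nat \<Rightarrow> nat \<Rightarrow> nat \<Rightarrow> bool"
    and R T :: "nat \<Rightarrow> nat \<Rightarrow> nat \<Rightarrow> nat \<Rightarrow> bool"
  assumes decidable_V: "decidable (\<lambda>e. V (e 0) (e 1) (e 2))"
    and decidable_R: "decidable (\<lambda>e. R (e 0) (e 1) (e 2) (e 3))"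
    and decidable_T: "decidable (\<lambda>e. T (e 0) (e 1) (e 2) (e 3))"
    and \<theta>_iff: "\<theta> n x = Some y \<longleftrightarrow> (\<exists>w. R w n x y)"
    and \<beta>_iff: "\<beta> b x = Some y \<longleftrightarrow> (\<exists>w. T w b x y)"
    and inj_\<beta>: "inj \<beta>"
    and dense: "finite D \<Longrightarrow> infinite {b. \<theta> n |` D \<subseteq>\<^sub>m \<beta> b}"
    and disjoint: "\<theta> n \<noteq> \<beta> b"
    and inj_alive: "inj_on \<theta> {n. \<forall>s. V i n s}"
    and infinite_fillers: "infinite {n. \<not> V i n 0}"
begin

definition dies :: "nat \<Rightarrow> nat \<Rightarrow> nat \<Rightarrow> bool" where
  "dies i n d \<longleftrightarrow> \<not> V i n d \<and> (\<forall>s<d. V i n s)"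

text \<open>The function \<open>\<beta> b\<close> is seen, with witnesses below \<open>w\<close>, to extend the finite part of \<open>\<theta> n\<close> that
  appears below stage \<open>d\<close>.\<close>

definition extends :: "nat \<Rightarrow> nat \<Rightarrow> nat \<Rightarrow> nat \<Rightarrow> bool" where
  "extends n d b w \<longleftrightarrow> (\<forall>x<d. \<forall>y<d. (\<exists>u<d. R u n x y) \<longrightarrow> (\<exists>u<w. T u b x y))"

text \<open>Heirs are distributed along the natural numbers \<open>s = \<langle>n, d\<rangle>\<close> rather than along indices. That \<open>n\<close>
dies at stage \<open>d\<close> is decidable, whereas whether \<open>n\<close> dies at all is not.\<close>

definition death :: "nat \<Rightarrow> nat \<Rightarrow> bool" where
  "death i s \<longleftrightarrow> dies i (fst (prod_decode s)) (snd (prod_decode s))"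

text \<open>A candidate \<open>z = \<langle>b, w\<rangle>\<close> consists of an index \<open>b\<close> not given away before and a bound \<open>w\<close> for the
confirmation that \<open>\<beta> b\<close> extends the finite part already computed. Taking the least pair makes
the search terminate and still reaches every \<open>b\<close>.\<close>

definition suitable :: "nat \<Rightarrow> (nat \<Rightarrow> nat) \<Rightarrow> nat \<Rightarrow> nat \<Rightarrow> bool" where
  "suitable i h s z \<longleftrightarrow>
     (\<forall>r<s. death i r \<longrightarrow> fst (prod_decode (h r)) \<noteq> fst (prod_decode z)) \<and>
     extends (fst (prod_decode s)) (snd (prod_decode s)) (fst (prod_decode z)) (snd (prod_decode z))"

definition selects :: "nat \<Rightarrow> (nat \<Rightarrow> nat) \<Rightarrow> nat \<Rightarrow> nat \<Rightarrow> bool" where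
  "selects i h s z \<longleftrightarrow>
     death i s \<and> suitable i h s z \<and> (\<forall>z'<z. \<not> suitable i h s z') \<or> \<not> death i s \<and> z = 0"

lemma dies_unique: "dies i n d \<Longrightarrow> dies i n d' \<Longrightarrow> d = d'"
  unfolding dies_def by (metis linorder_neqE_nat)

lemma not_alive_dies:
  assumes "\<not> V i n s" shows "\<exists>d. dies i n d"
  using exists_least_iff[of "\<lambda>d. \<not> V i n d"] assms unfolding dies_def by auto

lemma extends_iff_ex:
  "(\<exists>w. extends n d b w) \<longleftrightarrow> (\<forall>x<d. \<forall>y<d. (\<exists>u<d. R u n x y) \<longrightarrow> \<beta> b x = Some y)"
proof
  assume "\<exists>w. extends n d b w"
  then show "\<forall>x<d. \<forall>y<d. (\<exists>u<d. R u n x y) \<longrightarrow> \<beta> b x = Some y"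
    unfolding extends_def \<beta>_iff by blast
next
  assume *: "\<forall>x<d. \<forall>y<d. (\<exists>u<d. R u n x y) \<longrightarrow> \<beta> b x = Some y"
  define u where "u x y = (SOME u. T u b x y)" for x y
  have u: "T (u x y) b x y" if "x < d" "y < d" "\<exists>u<d. R u n x y" for x y
    using * that unfolding u_def \<beta>_iff by (metis someI_ex)
  \<comment> \<open>The sum is a common bound for the finitely many witnesses.\<close>
  define w where "w = Suc (\<Sum>x<d. \<Sum>y<d. u x y)"
  have "u x y < w" if "x < d" "y < d" for x y
  proof -
    have "u x y \<le> (\<Sum>y<d. u x y)" using that by (intro member_le_sum) auto
    also have "\<dots> \<le> (\<Sum>x<d. \<Sum>y<d. u x y)"
      using that by (intro member_le_sum[where f="\<lambda>x. \<Sum>y<d. u x y"]) auto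
    finally show ?thesis by (simp add: w_def)
  qed
  with u have "extends n d b w" unfolding extends_def by blast
  then show "\<exists>w. extends n d b w" ..
qed

text \<open>Strong density leaves infinitely many extensions, of which only finitely many are taken.\<close>

lemma ex_suitable: "\<exists>z. suitable i h s z"
proof -
  obtain n d where s: "prod_decode s = (n, d)" by fastforce
  define U where "U = {b. \<theta> n |` {..<d} \<subseteq>\<^sub>m \<beta> b} - (\<lambda>r. fst (prod_decode (h r))) ` {..<s}"
  have "infinite U" unfolding U_def using dense by (intro Diff_infinite_finite) auto
  then obtain b where "b \<in> U" by (metis finite.emptyI ex_in_conv)
  then have b: "\<theta> n |` {..<d} \<subseteq>\<^sub>m \<beta> b" "\<forall>r<s. fst (prod_decode (h r)) \<noteq> b"
    by (auto simp: U_def)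
  have "\<beta> b x = Some y" if "x < d" "R u n x y" for x y u
  proof -
    have "(\<theta> n |` {..<d}) x = Some y" using that \<theta>_iff by auto
    then show ?thesis using b(1) by (metis domI map_le_def)
  qed
  then obtain w where "extends n d b w" using extends_iff_ex by blast
  then have "suitable i h s (prod_encode (b, w))" using b(2) by (simp add: suitable_def s)
  then show ?thesis ..
qed

lemma selects_cong:
  assumes "\<And>r. r < s \<Longrightarrow> g r = h r" shows "selects i g s z \<longleftrightarrow> selects i h s z"
  unfolding selects_def suitable_def using assms by simp

lemma selects_unique: "selects i h s z \<Longrightarrow> selects i h s z' \<Longrightarrow> z = z'"
  unfolding selects_def by (metis linorder_neqE_nat)

lemma ex_selects: "\<exists>z. selects i h s z"
proof (cases "death i s")
  case True
  obtain z where "suitable i h s z" "\<forall>z'<z. \<not> suitable i h s z'"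
    using exists_least_iff[THEN iffD1, OF ex_suitable] by blast
  with True show ?thesis unfolding selects_def by blast
qed (simp add: selects_def)

lemma ex_greedy: "\<exists>h. \<forall>s. selects i h s (h s)"
proof (rule dependent_wf_choice[OF wf_less_than])
  show "selects i g s z = selects i h s z" if "\<And>r. (r, s) \<in> less_than \<Longrightarrow> g r = h r" for g h s z
    using that by (intro selects_cong) simp
qed (rule ex_selects)

definition greedy :: "nat \<Rightarrow> nat \<Rightarrow> nat" where
  "greedy i = (SOME h. \<forall>s. selects i h s (h s))"

lemma greedy: "selects i (greedy i) s (greedy i s)"
  using someI_ex[OF ex_greedy] unfolding greedy_def by blast

definition heir :: "nat \<Rightarrow> nat \<Rightarrow> nat \<Rightarrow> nat" where
  "heir i n d = fst (prod_decode (greedy i (prod_encode (n, d))))"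

definition \<nu> :: "nat \<Rightarrow> nat \<Rightarrow> nat \<Rightarrow> nat option" where
  "\<nu> i n = (if \<exists>d. dies i n d then \<beta> (heir i n (THE d. dies i n d)) else \<theta> n)"

lemma \<nu>_alive: "(\<And>s. V i n s) \<Longrightarrow> \<nu> i n = \<theta> n"
  by (simp add: \<nu>_def dies_def)

lemma \<nu>_dies:
  assumes "dies i n d" shows "\<nu> i n = \<beta> (heir i n d)"
proof -
  have "(THE d. dies i n d) = d" using assms dies_unique by (intro the_equality)
  then show ?thesis using assms unfolding \<nu>_def by auto
qed

lemma alive_or_dies: obtains (alive) "\<And>s. V i n s" | (dies) d where "dies i n d"
  using not_alive_dies by blast

lemma heir_extends:
  assumes "dies i n d" "x < d" "y < d" "u < d" "R u n x y"
  shows "\<beta> (heir i n d) x = Some y"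
proof -
  have "suitable i (greedy i) (prod_encode (n, d)) (greedy i (prod_encode (n, d)))"
    using greedy[of i "prod_encode (n, d)"] assms(1) unfolding selects_def death_def by simp
  then have "\<exists>w. extends n d (heir i n d) w" unfolding suitable_def heir_def by auto
  then show ?thesis using assms extends_iff_ex by blast
qed

lemma greedy_distinct:
  assumes "death i r" "death i s" "r < s"
  shows "fst (prod_decode (greedy i r)) \<noteq> fst (prod_decode (greedy i s))"
  using greedy[of i s] assms unfolding selects_def suitable_def by simp

lemma heir_inject:
  assumes "dies i n d" "dies i n' d'" "heir i n d = heir i n' d'" shows "n = n'"
proof (rule ccontr)
  assume "n \<noteq> n'"
  then have "prod_encode (n, d) \<noteq> prod_encode (n', d')" by (simp add: prod_encode_eq)
  then show False
    using assms greedy_distinct[of i "prod_encode (n, d)" "prod_encode (n', d')"]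
      greedy_distinct[of i "prod_encode (n', d')" "prod_encode (n, d)"]
    unfolding heir_def death_def by (metis fst_conv linorder_neqE_nat prod_encode_inverse snd_conv)
qed

lemma inj_\<nu>: "inj (\<nu> i)"
proof (rule injI)
  fix n n' assume eq: "\<nu> i n = \<nu> i n'"
  show "n = n'"
  proof (cases rule: alive_or_dies[of i n])
    case alive
    show ?thesis
    proof (cases rule: alive_or_dies[of i n'])
      case alive': alive
      have "\<theta> n = \<theta> n'" using eq alive alive' by (simp add: \<nu>_alive)
      then show ?thesis by (rule inj_onD[OF inj_alive[of i]]) (use alive alive' in blast)+
    next
      case (dies d)
      then show ?thesis using eq alive disjoint by (simp add: \<nu>_alive \<nu>_dies)
    qed
  next
    case (dies d)
    show ?thesis
    proof (cases rule: alive_or_dies[of i n'])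
      case alive
      then show ?thesis using eq dies disjoint by (metis \<nu>_alive \<nu>_dies)
    next
      case (dies d')
      then show ?thesis
        using eq \<open>dies i n d\<close> heir_inject injD[OF inj_\<beta>] by (simp add: \<nu>_dies)
    qed
  qed
qed

text \<open>An index that dies at stage \<open>0\<close> has computed nothing, so \<open>\<langle>b, 0\<rangle>\<close> is suitable for it as long as
\<open>b\<close> is unused. If \<open>b\<close> were never used, infinitely many such indices would have distinct heirs
below \<open>\<langle>b, 0\<rangle>\<close>.\<close>

lemma heir_surj: "\<exists>n d. dies i n d \<and> heir i n d = b"
proof (rule ccontr)
  assume *: "\<nexists>n d. dies i n d \<and> heir i n d = b"
  have "heir i n 0 \<le> prod_encode (b, 0)" if "\<not> V i n 0" for n
  proof -
    let ?s = "prod_encode (n, 0)"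
    have "dies i n 0" using that by (simp add: dies_def)
    then have ev: "death i ?s" by (simp add: death_def)
    have "suitable i (greedy i) ?s (prod_encode (b, 0))"
      using * unfolding suitable_def death_def heir_def
      by (auto simp: extends_def) (metis prod.collapse prod_decode_inverse)
    then have "greedy i ?s \<le> prod_encode (b, 0)"
      using greedy[of i ?s] ev unfolding selects_def by (meson not_le)
    then show ?thesis
      unfolding heir_def by (metis le_prod_encode_1 order_trans prod.collapse prod_decode_inverse)
  qed
  then have "(\<lambda>n. heir i n 0) ` {n. \<not> V i n 0} \<subseteq> {..prod_encode (b, 0)}" by auto
  then have "finite ((\<lambda>n. heir i n 0) ` {n. \<not> V i n 0})" by (rule finite_subset) simp
  moreover have "inj_on (\<lambda>n. heir i n 0) {n. \<not> V i n 0}"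
    by (rule inj_onI, rule heir_inject[of i _ 0 _ 0]) (auto simp: dies_def)
  ultimately show False using infinite_fillers finite_imageD by blast
qed

lemma range_\<nu>: "range (\<nu> i) = \<theta> ` {n. \<forall>s. V i n s} \<union> range \<beta>"
proof (intro equalityI subsetI)
  fix f assume "f \<in> range (\<nu> i)"
  then obtain n where "f = \<nu> i n" by blast
  then show "f \<in> \<theta> ` {n. \<forall>s. V i n s} \<union> range \<beta>"
    by (cases rule: alive_or_dies[of i n]) (auto simp: \<nu>_alive \<nu>_dies)
next
  fix f assume "f \<in> \<theta> ` {n. \<forall>s. V i n s} \<union> range \<beta>"
  then consider n where "\<And>s. V i n s" "f = \<theta> n" | b where "f = \<beta> b" by blast
  then show "f \<in> range (\<nu> i)"
  proof cases
    case 1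
    then show ?thesis using \<nu>_alive by (metis rangeI)
  next
    case 2
    then show ?thesis using heir_surj[of i b] \<nu>_dies by (metis rangeI)
  qed
qed

lemma decidable_dies: "decidable (\<lambda>e. dies (e 0) (e 1) (e 2))"
  unfolding dies_def by (intro computability_intros decidable_subst3[OF decidable_V])

lemma decidable_extends: "decidable (\<lambda>e. extends (e 0) (e 1) (e 2) (e 3))"
  unfolding extends_def
  by (intro computability_intros decidable_subst4[OF decidable_R] decidable_subst4[OF decidable_T])

text \<open>Course-of-values recursion is expressed by the existence of a code for the sequence of all
choices up to \<open>s\<close>.\<close>

lemma greedy_history:
  "greedy i s = z \<longleftrightarrow> (\<exists>c. (\<forall>r\<le>s. selects i (entry c) r (entry c r)) \<and> entry c s = z)"
proof
  assume z: "greedy i s = z"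
  define c where "c = list_encode (map (greedy i) [0..<Suc s])"
  have c: "entry c r = greedy i r" if "r \<le> s" for r
    using that unfolding c_def by (subst entry_list_encode) (auto simp del: upt_Suc)
  have "selects i (entry c) r (entry c r)" if "r \<le> s" for r
    using greedy[of i r] c that selects_cong[of r "entry c" "greedy i"] by simp
  then show "\<exists>c. (\<forall>r\<le>s. selects i (entry c) r (entry c r)) \<and> entry c s = z"
    using c[of s] z by blast
next
  assume "\<exists>c. (\<forall>r\<le>s. selects i (entry c) r (entry c r)) \<and> entry c s = z"
  then obtain c where c: "\<forall>r\<le>s. selects i (entry c) r (entry c r)" "entry c s = z" by blast
  have "r \<le> s \<Longrightarrow> entry c r = greedy i r" for r
  proof (induction r rule: less_induct)
    case (less r)
    have "selects i (entry c) r (entry c r)" using c(1) less.prems by blast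
    then have "selects i (greedy i) r (entry c r)"
      by (rule selects_cong[THEN iffD1, rotated]) (use less in simp)
    then show ?case using greedy selects_unique by blast
  qed
  then show "greedy i s = z" using c(2) by simp
qed

lemma semidecidable_greedy: "semidecidable (\<lambda>e. greedy (e 0) (e 1) = e 2)"
  unfolding greedy_history selects_def suitable_def death_def
  by (rule semidecidable_ex semidecidable_conj semidecidable_all_le semidecidable_decidable
      decidable_subst3[OF decidable_dies] decidable_subst4[OF decidable_extends]
      computability_intros computable_entry)+

text \<open>The alternative for surviving indices may be used for a dying index as well, as long as the
argument, the value and the witness stay below the stage of its death: its heir agrees with
\<open>\<theta> n\<close> there. This avoids the undecidable question whether the index dies.\<close>

lemma \<nu>_iff:
  "\<nu> i n x = Some y \<longleftrightarrow>
     (\<exists>u. R u n x y \<and> (\<forall>d\<le>u + x + y. \<not> dies i n d)) \<or>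
     (\<exists>d. dies i n d \<and> (\<exists>z. greedy i (prod_encode (n, d)) = z \<and> (\<exists>w. T w (fst (prod_decode z)) x y)))"
proof (cases rule: alive_or_dies[of i n])
  case alive
  then have "\<not> dies i n d" for d by (simp add: dies_def)
  then show ?thesis using \<nu>_alive[OF alive] \<theta>_iff by simp
next
  case (dies d)
  then have "dies i n d' \<longleftrightarrow> d' = d" for d' using dies_unique by blast
  moreover have "\<beta> (heir i n d) x = Some y" if "R u n x y" "\<forall>d'\<le>u + x + y. d' \<noteq> d" for u
  proof -
    have "u + x + y < d" using that(2) by (metis not_less)
    then show ?thesis using heir_extends[OF dies, of x y u] that(1) by simp
  qed
  ultimately show ?thesis
    using \<nu>_dies[OF dies] \<beta>_iff[of "heir i n d"] unfolding heir_def by auto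
qed

lemma uniformly_ce_\<nu>: "uniformly_ce \<nu>"
  unfolding uniformly_ce_def
proof (rule partial_computable3I)
  have "semidecidable (\<lambda>e. \<nu> (e 1) (e 2) (e 3) = Some (e 0))"
    unfolding \<nu>_iff
    by (rule semidecidable_disj semidecidable_ex semidecidable_conj
        semidecidable_subst3[OF semidecidable_greedy] semidecidable_decidable
        decidable_subst3[OF decidable_dies] decidable_subst4[OF decidable_R]
        decidable_subst4[OF decidable_T] computability_intros)+
  then show "semidecidable (\<lambda>e. \<nu> (e 1) (e 2) (e 3) = Some (e 0))" .
qed

end

section \<open>Unique refutable guesses for minimal indices\<close>

text \<open>Witnesses of a \<open>\<Sigma>\<^sub>2\<close> property can be made unique while being a witness stays \<open>\<Pi>\<^sub>1\<close>: take the least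
\<open>m\<close> that works together with the least bound \<open>w\<close> for the stages that refute all smaller ones.\<close>

lemma unique_witness:
  assumes Q: "decidable (\<lambda>e. Q (e 0) (e 1) (e 2))"
  obtains V where "decidable (\<lambda>e. V (e 0) (e 1) (e 2))"
    and "\<And>a v v'. \<lbrakk>\<forall>s. V a v s; \<forall>s. V a v' s\<rbrakk> \<Longrightarrow> v = v'"
    and "\<And>a. (\<exists>v. \<forall>s. V a v s) \<longleftrightarrow> (\<exists>m. \<forall>s. Q a m s)"
proof -
  define refuted where "refuted a m w \<longleftrightarrow> (\<forall>k<m. \<exists>s<w. \<not> Q a k s)" for a m w
  define V where "V a v s \<longleftrightarrow> Q a (fst (prod_decode v)) s \<and>
    refuted a (fst (prod_decode v)) (snd (prod_decode v)) \<and>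
    (\<forall>w<snd (prod_decode v). \<not> refuted a (fst (prod_decode v)) w)" for a v s
  have "decidable (\<lambda>e. V (e 0) (e 1) (e 2))"
    unfolding V_def refuted_def
    by (intro computability_intros decidable_subst3[OF Q])
  moreover have "v = v'" if "\<forall>s. V a v s" "\<forall>s. V a v' s" for a v v'
  proof -
    obtain m w m' w' where v: "v = prod_encode (m, w)" "v' = prod_encode (m', w')"
      by (metis prod.collapse prod_decode_inverse)
    have "m = m'"
      using that unfolding V_def refuted_def v by simp (metis linorder_neqE_nat)
    moreover from this have "w = w'"
      using that unfolding V_def v by simp (metis linorder_neqE_nat)
    ultimately show ?thesis by (simp add: v)
  qed
  moreover have "(\<exists>v. \<forall>s. V a v s) \<longleftrightarrow> (\<exists>m. \<forall>s. Q a m s)" for a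
  proof
    assume "\<exists>m. \<forall>s. Q a m s"
    then obtain m where m: "\<forall>s. Q a m s" "\<forall>k<m. \<not> (\<forall>s. Q a k s)"
      using exists_least_iff[of "\<lambda>m. \<forall>s. Q a m s"] by blast
    then obtain s where s: "\<not> Q a k (s k)" if "k < m" for k by metis
    have "s k < Suc (\<Sum>k<m. s k)" if "k < m" for k
      using that by (auto simp: less_Suc_eq_le intro: member_le_sum)
    with s have "refuted a m (Suc (\<Sum>k<m. s k))" unfolding refuted_def by blast
    then obtain w where "refuted a m w" "\<forall>w'<w. \<not> refuted a m w'"
      using exists_least_iff[of "refuted a m"] by blast
    then have "\<forall>s. V a (prod_encode (m, w)) s" using m(1) by (simp add: V_def)
    then show "\<exists>v. \<forall>s. V a v s" ..
  qed (auto simp: V_def)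
  ultimately show ?thesis using that by blast
qed

lemma partial_computable2_graph:
  assumes "partial_computable2 \<phi>"
  obtains R where "decidable (\<lambda>e. R (e 0) (e 1) (e 2) (e 3))"
    and "\<And>i x y. \<phi> i x = Some y \<longleftrightarrow> (\<exists>w. R w i x y)"
  using semidecidable_witness3[where P="\<lambda>i x y. \<phi> i x = Some y",
      OF semidecidable_partial_computable2[OF assms]] by blast

text \<open>Two functions with different graphs are told apart by one fixed argument at all late stages,
whereas approximations of the same function agree on any finite set of arguments from some
stage on. This gives minimality of an index in \<open>\<Sigma>\<^sub>2\<close> form.\<close>

lemma distinct_in_limit:
  fixes \<phi> :: "nat \<Rightarrow> nat \<Rightarrow> nat option" and R :: "nat \<Rightarrow> nat \<Rightarrow> nat \<Rightarrow> nat \<Rightarrow> bool"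
  assumes \<phi>: "\<And>i x y. \<phi> i x = Some y \<longleftrightarrow> (\<exists>w. R w i x y)"
  shows "(\<exists>m. \<forall>s\<ge>m. \<forall>j<a. \<exists>x\<le>m. \<exists>y<s. (\<exists>w<s. R w a x y) \<noteq> (\<exists>w<s. R w j x y)) \<longleftrightarrow>
    (\<forall>j<a. \<phi> a \<noteq> \<phi> j)" (is "(\<exists>m. ?Q m) \<longleftrightarrow> _")
proof
  assume "\<exists>m. ?Q m"
  then obtain m where m: "?Q m" ..
  show "\<forall>j<a. \<phi> a \<noteq> \<phi> j"
  proof (intro allI impI notI)
    fix j assume "j < a" and eq: "\<phi> a = \<phi> j"
    have "\<forall>\<^sub>F s in sequentially. \<forall>y. (\<exists>w<s. R w a x y) = (\<exists>w<s. R w j x y)" for x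
    proof (cases "\<phi> a x")
      case None
      then have "\<not> R w a x y" "\<not> R w j x y" for w y using \<phi> eq by (metis option.distinct(1))+
      then show ?thesis by simp
    next
      case (Some z)
      then obtain v w where vw: "R v a x z" "R w j x z" using \<phi> eq by metis
      have only: "y = z" if "R u a x y \<or> R u j x y" for u y
        using that Some \<phi> eq by (metis option.inject)
      show ?thesis
        using eventually_gt_at_top[of "max v w"]
      proof eventually_elim
        case (elim s)
        then show ?case using vw only by (metis max_less_iff_conj)
      qed
    qed
    then have "\<forall>\<^sub>F s in sequentially. \<forall>x\<in>{..m}. \<forall>y. (\<exists>w<s. R w a x y) = (\<exists>w<s. R w j x y)"
      by (intro eventually_ball_finite) auto
    then obtain s where "s \<ge> m" "\<forall>x\<le>m. \<forall>y. (\<exists>w<s. R w a x y) = (\<exists>w<s. R w j x y)"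
      unfolding eventually_sequentially by (metis atMost_iff nle_le)
    then show False using m \<open>j < a\<close> by blast
  qed
next
  assume *: "\<forall>j<a. \<phi> a \<noteq> \<phi> j"
  define differ where "differ s j x y \<longleftrightarrow> (\<exists>w<s. R w a x y) \<noteq> (\<exists>w<s. R w j x y)" for s j x y
  have "\<forall>\<^sub>F m in sequentially. \<forall>s\<ge>m. \<exists>x\<le>m. \<exists>y<s. differ s j x y" if "j < a" for j
  proof -
    obtain x where "\<phi> a x \<noteq> \<phi> j x" using * \<open>j < a\<close> by blast
    then obtain y where "(\<phi> a x = Some y) \<noteq> (\<phi> j x = Some y)" by (metis option.exhaust)
    then obtain w where w: "R w a x y \<and> \<phi> j x \<noteq> Some y \<or> R w j x y \<and> \<phi> a x \<noteq> Some y"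
      using \<phi> by metis
    show ?thesis
      using eventually_gt_at_top[of "x + y + w"]
    proof eventually_elim
      case (elim m)
      have "differ s j x y" if "s \<ge> m" for s
      proof -
        have "w < s" using elim that by linarith
        then show ?thesis using w \<phi> unfolding differ_def by metis
      qed
      moreover have "x \<le> m" "\<And>s. s \<ge> m \<Longrightarrow> y < s" using elim by auto
      ultimately show ?case by blast
    qed
  qed
  then have "\<forall>\<^sub>F m in sequentially. \<forall>j\<in>{..<a}. \<forall>s\<ge>m. \<exists>x\<le>m. \<exists>y<s. differ s j x y"
    by (intro eventually_ball_finite) auto
  then obtain m where "\<forall>j\<in>{..<a}. \<forall>s\<ge>m. \<exists>x\<le>m. \<exists>y<s. differ s j x y"
    unfolding eventually_sequentially by blast
  then have "\<forall>s\<ge>m. \<forall>j<a. \<exists>x\<le>m. \<exists>y<s. differ s j x y" by simp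
  then show "\<exists>m. ?Q m" unfolding differ_def by (rule exI)
qed

lemma pi1_minimal_indices:
  assumes "partial_computable2 \<alpha>"
  obtains V where "decidable (\<lambda>e. V (e 0) (e 1) (e 2))"
    and "\<And>a v v'. \<lbrakk>\<forall>s. V a v s; \<forall>s. V a v' s\<rbrakk> \<Longrightarrow> v = v'"
    and "\<And>a. (\<exists>v. \<forall>s. V a v s) \<longleftrightarrow> (\<forall>j<a. \<alpha> a \<noteq> \<alpha> j)"
proof -
  obtain R where R: "decidable (\<lambda>e. R (e 0) (e 1) (e 2) (e 3))"
    and \<alpha>: "\<And>i x y. \<alpha> i x = Some y \<longleftrightarrow> (\<exists>w. R w i x y)"
    using partial_computable2_graph[OF assms] by blast
  define S where "S s i x y \<longleftrightarrow> (\<exists>w<s. R w i x y)" for s i x y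
  define Q where "Q a m s \<longleftrightarrow> (m \<le> s \<longrightarrow> (\<forall>j<a. \<exists>x\<le>m. \<exists>y<s.
    S s a x y \<and> \<not> S s j x y \<or> \<not> S s a x y \<and> S s j x y))" for a m s
  have S: "decidable (\<lambda>e. S (e 0) (e 1) (e 2) (e 3))"
    unfolding S_def by (intro computability_intros decidable_subst4[OF R])
  have Q: "decidable (\<lambda>e. Q (e 0) (e 1) (e 2))"
    unfolding Q_def by (intro computability_intros decidable_subst4[OF S])
  have xor: "(p \<and> \<not> q \<or> \<not> p \<and> q) = (p \<noteq> q)" for p q by blast
  have "(\<forall>s. Q a m s) \<longleftrightarrow>
      (\<forall>s\<ge>m. \<forall>j<a. \<exists>x\<le>m. \<exists>y<s. (\<exists>w<s. R w a x y) \<noteq> (\<exists>w<s. R w j x y))" for a m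
    unfolding Q_def xor S_def ..
  then have minimal: "(\<exists>m. \<forall>s. Q a m s) \<longleftrightarrow> (\<forall>j<a. \<alpha> a \<noteq> \<alpha> j)" for a
    using distinct_in_limit[of \<alpha> R a, OF \<alpha>] by simp
  show ?thesis by (rule unique_witness[OF Q]) (rule that, simp_all only: minimal)
qed

section \<open>Diagonalisation and independence\<close>

lemma constant_recf: "\<exists>q. \<forall>xs. reval q xs = Some c"
proof (induction c)
  case 0
  show ?case by (intro exI[of _ Zero]) simp
next
  case (Suc c)
  then obtain q where "\<forall>xs. reval q xs = Some c" ..
  then show ?case by (intro exI[of _ "Comp Succ [q]"]) simp
qed

lemma uniformly_ce_section:
  assumes "uniformly_ce \<nu>" shows "partial_computable2 (\<nu> i)"
proof -
  obtain p where p: "\<And>i n x. reval p [i, n, x] = \<nu> i n x"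
    using assms unfolding uniformly_ce_def partial_computable3_def by blast
  obtain q where q: "\<And>xs. reval q xs = Some i" using constant_recf by blast
  have "reval (Comp p [q, Proj 0, Proj 1]) [n, x] = \<nu> i n x" for n x
    by (simp add: p q)
  then show ?thesis unfolding partial_computable2_def by blast
qed

text \<open>Indices are triples of a tag, an index of a function and a guess. Tag \<open>0\<close> is for followers of
members of \<open>A\<close>, tag \<open>1\<close> for \<open>C\<close>, and all other tags for indices that die at once. The anchor of
\<open>k\<close> carries the initial guess that \<open>\<gamma> k\<close> never has to leave it.\<close>

definition anchor :: "nat \<Rightarrow> nat" where
  "anchor k = prod_encode (1, prod_encode (k, 0))"

text \<open>Writing \<open>k = \<langle>i, e\<rangle>\<close>, the \<open>e\<close>-th function sends the anchor of \<open>k\<close> to the same anchor in some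
component of the direct sum.\<close>

definition claimed :: "nat \<Rightarrow> nat \<Rightarrow> bool" where
  "claimed i k \<longleftrightarrow> fst (prod_decode k) = i \<and>
     (\<exists>j. evaluates (snd (prod_decode k)) (Suc (prod_encode (anchor k, 0)))
       (prod_encode (j, anchor k)))"

lemma semidecidable_claimed: "semidecidable (\<lambda>e. claimed (e 0) (e 1))"
  unfolding claimed_def anchor_def
  by (rule semidecidability_intros semidecidable_subst3[OF semidecidable_evaluates]
      semidecidable_decidable computability_intros)+

lemma claimed_prod_encode:
  assumes "\<And>x. reval p [x] = Some (f x)"
  shows "claimed i' (prod_encode (i, recf_code p)) \<longleftrightarrow>
    i = i' \<and> snd (prod_decode (f (anchor (prod_encode (i, recf_code p))))) =
      anchor (prod_encode (i, recf_code p))"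
proof -
  define c where "c = anchor (prod_encode (i, recf_code p))"
  have "evaluates (recf_code p) (Suc (prod_encode (c, 0))) y \<longleftrightarrow> f c = y" for y
    using evaluates_iff[of p "[c]" y] assms by simp
  moreover have "(\<exists>j. f c = prod_encode (j, c)) \<longleftrightarrow> snd (prod_decode (f c)) = c"
    by (metis prod.collapse prod_decode_inverse prod_encode_inverse snd_conv)
  ultimately show ?thesis unfolding claimed_def by (auto simp: c_def[symmetric])
qed

text \<open>The number \<open>k = \<langle>i, code of f\<rangle>\<close> refutes a reduction \<open>f\<close> of \<open>\<nu> i\<close>. Let \<open>f (anchor k) = \<langle>j', m\<rangle>\<close>. If
\<open>m = anchor k\<close> then \<open>k\<close> is claimed for \<open>i\<close> but not for the component, and the two values differ; if
not, both numberings have \<open>\<gamma> k\<close> at its anchor, and injectivity of the component is violated.\<close>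

lemma independent_seqI:
  assumes inj: "\<And>i. inj (\<nu> i)"
    and anchor: "\<And>j k. \<not> claimed j k \<Longrightarrow> \<nu> j (anchor k) = \<gamma> k"
    and claimed: "\<And>i k. claimed i k \<Longrightarrow> \<nu> i (anchor k) \<noteq> \<gamma> k"
  shows "independent_seq \<nu>"
  unfolding independent_seq_def
proof (intro allI notI)
  fix i assume "reducible (\<nu> i) (direct_sum (omit i \<nu>))"
  then obtain f p where f: "\<nu> i = direct_sum (omit i \<nu>) \<circ> f" and p: "\<And>x. reval p [x] = Some (f x)"
    unfolding reducible_def total_computable_def partial_computable1_def by blast
  define k where "k = prod_encode (i, recf_code p)"
  obtain j' m where jm: "f (anchor k) = prod_encode (j', m)"
    by (metis prod.collapse prod_decode_inverse)
  \<comment> \<open>\<open>omit\<close> skips position \<open>i\<close>, so the \<open>j'\<close>-th summand is the \<open>j\<close>-th numbering.\<close>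
  define j where "j = (if j' < i then j' else Suc j')"
  have "j \<noteq> i" by (simp add: j_def)
  have eq: "\<nu> i (anchor k) = \<nu> j m"
    by (simp add: f jm direct_sum_prod_encode omit_def j_def)
  have claim: "claimed i' k \<longleftrightarrow> i = i' \<and> m = anchor k" for i'
    using claimed_prod_encode[of p f i' i, OF p] jm by (simp add: k_def)
  then have j: "\<nu> j (anchor k) = \<gamma> k" using anchor \<open>j \<noteq> i\<close> by simp
  show False
  proof (cases "m = anchor k")
    case True
    then show False using claimed[of i k] claim eq j by simp
  next
    case False
    then have "\<nu> j m = \<nu> j (anchor k)" using anchor[of i k] claim eq j by simp
    then show False using False injD[OF inj] by blast
  qed
qed

theorem corollary10:
  fixes A B C :: "(nat \<Rightarrow> nat option) set"
  assumes "A \<subseteq> P1" and "B \<subseteq> P1" and "C \<subseteq> P1"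
    and "A \<inter> B = {}" and "A \<inter> C = {}" and "B \<inter> C = {}"
    and "\<exists>\<alpha>. computable_numbering A \<alpha>"
    and "\<exists>\<beta>. friedberg_numbering B \<beta>"
    and "\<exists>\<gamma>. friedberg_numbering C \<gamma>"
    and "strongly_dense B (A \<union> C)"
  shows "\<exists>\<nu>. uniformly_ce \<nu> \<and> independent_seq \<nu> \<and>
    (\<forall>i. friedberg_numbering (A \<union> B \<union> C) (\<nu> i))"
proof -
  obtain \<alpha> where A: "A = range \<alpha>" and \<alpha>: "partial_computable2 \<alpha>"
    using assms(7) unfolding computable_numbering_def numbering_def by blast
  obtain \<beta> where B: "B = range \<beta>" and \<beta>: "partial_computable2 \<beta>" and inj_\<beta>: "inj \<beta>"
    using assms(8) unfolding friedberg_numbering_def computable_numbering_def numbering_def by blast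
  obtain \<gamma> where C: "C = range \<gamma>" and \<gamma>: "partial_computable2 \<gamma>" and inj_\<gamma>: "inj \<gamma>"
    using assms(9) unfolding friedberg_numbering_def computable_numbering_def numbering_def by blast
  obtain RB where RB: "decidable (\<lambda>e. RB (e 0) (e 1) (e 2) (e 3))"
    and \<beta>_iff: "\<And>i x y. \<beta> i x = Some y \<longleftrightarrow> (\<exists>w. RB w i x y)"
    using partial_computable2_graph[OF \<beta>] by blast
  obtain RC where RC: "decidable (\<lambda>e. RC (e 0) (e 1) (e 2) (e 3))"
    and \<gamma>_iff: "\<And>i x y. \<gamma> i x = Some y \<longleftrightarrow> (\<exists>w. RC w i x y)"
    using partial_computable2_graph[OF \<gamma>] by blast
  obtain RA where RA: "decidable (\<lambda>e. RA (e 0) (e 1) (e 2) (e 3))"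
    and \<alpha>_iff: "\<And>i x y. \<alpha> i x = Some y \<longleftrightarrow> (\<exists>w. RA w i x y)"
    using partial_computable2_graph[OF \<alpha>] by blast
  obtain VA where VA: "decidable (\<lambda>e. VA (e 0) (e 1) (e 2))"
    and VA_unique: "\<And>a v v'. \<lbrakk>\<forall>s. VA a v s; \<forall>s. VA a v' s\<rbrakk> \<Longrightarrow> v = v'"
    and VA_minimal: "\<And>a. (\<exists>v. \<forall>s. VA a v s) \<longleftrightarrow> (\<forall>j<a. \<alpha> a \<noteq> \<alpha> j)"
    using pi1_minimal_indices[OF \<alpha>] by blast
  obtain E where E: "decidable (\<lambda>e. E (e 0) (e 1) (e 2))"
    and claimed_iff: "\<And>i k. claimed i k \<longleftrightarrow> (\<exists>s. E s i k)"
    using semidecidable_witness2[OF semidecidable_claimed] by blast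
  \<comment> \<open>Guess \<open>0\<close>: the anchor is never claimed. Guess \<open>Suc u\<close>: \<open>u\<close> is the first stage witnessing the
    claim. Exactly one guess is correct, and incorrect ones are refuted at some stage.\<close>
  define VC where "VC i k v s \<longleftrightarrow> v = 0 \<and> \<not> E s i k \<or>
    v \<noteq> 0 \<and> E (v - 1) i k \<and> (\<forall>u<v - 1. \<not> E u i k)" for i k v s
  have VC: "decidable (\<lambda>e. VC (e 0) (e 1) (e 2) (e 3))"
    unfolding VC_def by (intro computability_intros decidable_subst3[OF E])
  have VC_0: "(\<forall>s. VC i k 0 s) \<longleftrightarrow> \<not> claimed i k" for i k
    by (simp add: VC_def claimed_iff)
  have VC_Suc: "(\<forall>s. VC i k (Suc u) s) \<longleftrightarrow> E u i k \<and> (\<forall>r<u. \<not> E r i k)" for i k u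
    by (simp add: VC_def)
  have VC_unique: "v = v'" if "\<forall>s. VC i k v s" "\<forall>s. VC i k v' s" for i k v v'
    using that
    by (cases v; cases v') (auto simp: VC_0 VC_Suc claimed_iff, metis linorder_neqE_nat)
  have VC_ex: "\<exists>v. \<forall>s. VC i k v s" for i k
  proof (cases "claimed i k")
    case True
    then obtain u where "E u i k \<and> (\<forall>r<u. \<not> E r i k)"
      using exists_least_iff[of "\<lambda>s. E s i k"] claimed_iff by blast
    then show ?thesis using VC_Suc by blast
  qed (use VC_0 in blast)

  define tag where "tag n = fst (prod_decode n)" for n
  define idx where "idx n = fst (prod_decode (snd (prod_decode n)))" for n
  define guess where "guess n = snd (prod_decode (snd (prod_decode n)))" for n
  note parts = tag_def idx_def guess_def
  define \<theta> where "\<theta> n = (if tag n = 0 then \<alpha> (idx n) else \<gamma> (idx n))" for n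
  define R where "R w n x y \<longleftrightarrow> tag n = 0 \<and> RA w (idx n) x y \<or> tag n \<noteq> 0 \<and> RC w (idx n) x y"
    for w n x y
  define V where "V i n s \<longleftrightarrow> tag n = 0 \<and> VA (idx n) (guess n) s \<or>
    tag n = 1 \<and> VC i (idx n) (guess n) s" for i n s
  have eqI: "n = n'" if "tag n = tag n'" "idx n = idx n'" "guess n = guess n'" for n n'
    using that unfolding parts by (metis prod_decode_inverse prod.collapse)
  have alive: "(\<forall>s. V i n s) \<longleftrightarrow> tag n = 0 \<and> (\<forall>s. VA (idx n) (guess n) s) \<or>
    tag n = 1 \<and> (\<forall>s. VC i (idx n) (guess n) s)" for i n
    by (cases "tag n = 0"; cases "tag n = 1") (auto simp: V_def)
  have minimal: "a = a'" if "\<forall>s. VA a v s" "\<forall>s. VA a' v' s" "\<alpha> a = \<alpha> a'" for a a' v v'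
    using that VA_minimal by (metis linorder_neqE_nat)
  have \<theta>_range: "\<theta> n \<in> A \<union> C" for n by (simp add: \<theta>_def A C)

  interpret follower_system \<theta> \<beta> V R RB
  proof
    show "decidable (\<lambda>e. V (e 0) (e 1) (e 2))"
      unfolding V_def parts
      by (intro computability_intros decidable_subst3[OF VA] decidable_subst4[OF VC])
    show "decidable (\<lambda>e. R (e 0) (e 1) (e 2) (e 3))"
      unfolding R_def parts
      by (intro computability_intros decidable_subst4[OF RA] decidable_subst4[OF RC])
    show "\<theta> n x = Some y \<longleftrightarrow> (\<exists>w. R w n x y)" for n x y
      by (simp add: \<theta>_def R_def \<alpha>_iff \<gamma>_iff)
    show "infinite {b. \<theta> n |` D \<subseteq>\<^sub>m \<beta> b}" if "finite D" for n D
    proof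
      assume "finite {b. \<theta> n |` D \<subseteq>\<^sub>m \<beta> b}"
      then have "finite (\<beta> ` {b. \<theta> n |` D \<subseteq>\<^sub>m \<beta> b})" by (rule finite_imageI)
      also have "\<beta> ` {b. \<theta> n |` D \<subseteq>\<^sub>m \<beta> b} = {\<psi> \<in> B. \<theta> n |` D \<subseteq>\<^sub>m \<psi>}" by (auto simp: B)
      finally show False using assms(10) \<theta>_range that unfolding strongly_dense_def by blast
    qed
    show "\<theta> n \<noteq> \<beta> b" for n b using \<theta>_range[of n] assms(4,6) B by auto
    show "inj_on \<theta> {n. \<forall>s. V i n s}" for i
    proof (rule inj_onI, unfold mem_Collect_eq alive)
      fix n n' assume eq: "\<theta> n = \<theta> n'"
        and n: "tag n = 0 \<and> (\<forall>s. VA (idx n) (guess n) s) \<or> tag n = 1 \<and> (\<forall>s. VC i (idx n) (guess n) s)"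
        and n': "tag n' = 0 \<and> (\<forall>s. VA (idx n') (guess n') s) \<or> tag n' = 1 \<and> (\<forall>s. VC i (idx n') (guess n') s)"
      have "\<alpha> a \<noteq> \<gamma> c" for a c using assms(5) A C by auto
      then have tag: "tag n = tag n'" using eq n n' by (auto simp: \<theta>_def split: if_splits) metis
      show "n = n'"
      proof (cases "tag n = 0")
        case True
        then have idx: "idx n = idx n'" using eq n n' tag minimal by (auto simp: \<theta>_def)
        then have "guess n = guess n'" using True n n' tag VA_unique by auto
        then show ?thesis using tag idx eqI by blast
      next
        case False
        then have idx: "idx n = idx n'" using eq tag injD[OF inj_\<gamma>] by (simp add: \<theta>_def)
        then have "guess n = guess n'" using False n n' tag VC_unique by auto
        then show ?thesis using tag idx eqI by blast
      qed
    qed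
    show "infinite {n. \<not> V i n 0}" for i
    proof
      assume "finite {n. \<not> V i n 0}"
      moreover have "range (\<lambda>q. prod_encode (2, q)) \<subseteq> {n. \<not> V i n 0}" by (auto simp: V_def tag_def)
      ultimately have "finite (range (\<lambda>q. prod_encode (2, q)))" by (metis finite_subset)
      moreover have "inj (\<lambda>q. prod_encode (2, q))" by (simp add: inj_def prod_encode_eq)
      ultimately show False using finite_imageD by blast
    qed
  qed (use RB \<beta>_iff inj_\<beta> in simp_all)

  have "\<theta> ` {n. \<forall>s. V i n s} = A \<union> C" for i
  proof (intro equalityI subsetI)
    fix f assume "f \<in> A \<union> C"
    then consider a where "f = \<alpha> a" | k where "f = \<gamma> k" by (auto simp: A C)
    then show "f \<in> \<theta> ` {n. \<forall>s. V i n s}"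
    proof cases
      case 1
      then obtain a where a: "f = \<alpha> a" "\<forall>j<a. f \<noteq> \<alpha> j"
        using exists_least_iff[of "\<lambda>a. f = \<alpha> a"] by blast
      then obtain v where "\<forall>s. VA a v s" using VA_minimal by blast
      then have "\<forall>s. V i (prod_encode (0, prod_encode (a, v))) s" by (simp add: alive parts)
      moreover have "f = \<theta> (prod_encode (0, prod_encode (a, v)))" by (simp add: \<theta>_def parts a)
      ultimately show ?thesis by blast
    next
      case 2
      obtain v where "\<forall>s. VC i k v s" using VC_ex by blast
      then have "\<forall>s. V i (prod_encode (1, prod_encode (k, v))) s" by (simp add: alive parts)
      moreover have "f = \<theta> (prod_encode (1, prod_encode (k, v)))" by (simp add: \<theta>_def parts 2)
      ultimately show ?thesis by blast
    qed
  qed (use \<theta>_range in auto)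
  then have "range (\<nu> i) = A \<union> B \<union> C" for i using range_\<nu>[of i] B by auto
  then have friedberg: "friedberg_numbering (A \<union> B \<union> C) (\<nu> i)" for i
    using inj_\<nu> uniformly_ce_section[OF uniformly_ce_\<nu>]
    by (simp add: friedberg_numbering_def computable_numbering_def numbering_def)

  have \<theta>_anchor: "\<theta> (anchor k) = \<gamma> k" for k by (simp add: \<theta>_def parts anchor_def)
  have alive_anchor: "(\<forall>s. V i (anchor k) s) \<longleftrightarrow> \<not> claimed i k" for i k
    using VC_0 by (simp add: alive parts anchor_def)
  have "independent_seq \<nu>"
  proof (rule independent_seqI)
    show "\<nu> j (anchor k) = \<gamma> k" if "\<not> claimed j k" for j k
    proof -
      have "\<nu> j (anchor k) = \<theta> (anchor k)"
        by (rule \<nu>_alive) (use that alive_anchor in blast)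
      then show ?thesis by (simp add: \<theta>_anchor)
    qed
    show "\<nu> i (anchor k) \<noteq> \<gamma> k" if claim: "claimed i k" for i k
    proof -
      obtain d where "dies i (anchor k) d" using claim alive_anchor not_alive_dies by blast
      then show ?thesis using \<nu>_dies disjoint[of "anchor k"] \<theta>_anchor by metis
    qed
  qed (rule inj_\<nu>)
  with friedberg uniformly_ce_\<nu> show ?thesis by blast
qed

end
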